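(* Let $p\geq 1$ and $\gamma\in(2/3,1)$. Let $g:[1,\infty)\to[1,\infty)$ be a function with $g(n)\to\infty$ as $n\to\infty$ so slowly that $$\frac{g(n)}{n^{\gamma-2/3}}\to 0\quad\text{as } n\to\infty.$$ Then there exist a constant $C_{p}>0$, depending only on $p$, and $n_{*}\geq 2$ such that for all continuous, non-increasing functions $f:[0,\infty)\to(0,\infty)$ with $\int_{0}^{\infty} f(x)\,\mathrm{d}x=\infty$ and all integers $n\geq n_{*}$ $$\sup_{0\neq v\in\ell^{p}(\mathbb{Z})}\frac{1}{\|v\|^{p}_{\ell^{p}}}\sum_{\lambda\in\sigma_{\mathrm d}(J)}\frac{\mathrm{dist}(\lambda,[-2,2])^{p}}{|\lambda^{2}-4|^{1/2}}\,f\left(-\log\left(\frac{\mathrm{dist}(\lambda,[-2,2])}{\mathrm{dist}(\lambda,\{-2,2\})}\right)\right)\geq C_{p}\left(F(\log n^{2/3})-3f(0)\log g(n)\right),$$ where $F(t):=\int_{0}^{t} f(x)\,\mathrm{d}x$ for $t\geq 0$. (In particular $n_*$ does not depend on $f$.)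
   Context: Given bounded complex sequences $\{a_n\}_{n\in\mathbb{Z}},\{b_n\}_{n\in\mathbb{Z}},\{c_n\}_{n\in\mathbb{Z}}$, the Jacobi operator $J$ is the bounded operator in $\ell^2(\mathbb{Z})$ given by $(Ju)_n=a_{n-1}u_{n-1}+b_nu_n+c_nu_{n+1}$, $n\in\mathbb{Z}$. Associated with $J$ is the sequence $v=\{v_n\}_{n\in\mathbb{Z}}$, $$v_n:=\max\{|a_{n-1}-1|,|a_n-1|,|b_n|,|c_{n-1}-1|,|c_n-1|\}.$$ If $v_n\to0$ as $|n|\to\infty$, then the essential spectrum of $J$ is $[-2,2]$; $\sigma_{\mathrm d}(J)\subset\mathbb{C}\setminus[-2,2]$ denotes the discrete spectrum (isolated eigenvalues of finite algebraic multiplicity). In sums over $\sigma_{\mathrm d}(J)$ each eigenvalue is repeated according to its algebraic multiplicity. The supremum over $0\neq v\in\ell^p(\mathbb{Z})$ means the supremum over all Jacobi operators $J$ whose associated sequence $v$ is non-zero and belongs to $\ell^p(\mathbb{Z})$. *)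

theory Defs
  imports "HOL-Analysis.Analysis" "HOL-Library.Function_Algebras"
begin

text \<open>Two-sided sequences are functions \<open>int \<Rightarrow> 'a\<close>; \<open>\<ell>\<^sup>p(\<int>)\<close> is a subset of this type, so that
  an operator in \<open>\<ell>\<^sup>2(\<int>)\<close> is a map on sequences of which only the action on \<open>lp 2\<close> matters.\<close>

definition lp :: "real \<Rightarrow> (int \<Rightarrow> 'a::real_normed_vector) set"
  where "lp p = {u. (\<lambda>n. norm (u n) powr p) summable_on UNIV}"

definition lp_norm :: "real \<Rightarrow> (int \<Rightarrow> 'a::real_normed_vector) \<Rightarrow> real"
  where "lp_norm p u = (\<Sum>\<^sub>\<infinity>n. norm (u n) powr p) powr (1 / p)"

interpretation cseq: vector_space "\<lambda>(c::complex) (u::int \<Rightarrow> complex) n. c * u n"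
  by unfold_locales (auto simp: fun_eq_iff algebra_simps)

type_synonym seq_op = "(int \<Rightarrow> complex) \<Rightarrow> (int \<Rightarrow> complex)"

definition shifted :: "seq_op \<Rightarrow> complex \<Rightarrow> seq_op"
  where "shifted T z u = (\<lambda>n. T u n - z * u n)"

text \<open>The resolvent set: \<open>T - z\<close> is a bijection of \<open>\<ell>\<^sup>2(\<int>)\<close> onto itself with bounded inverse.\<close>

definition resolvent_set :: "seq_op \<Rightarrow> complex set"
  where "resolvent_set T = {z. bij_betw (shifted T z) (lp 2) (lp 2) \<and>
    (\<exists>K. \<forall>u\<in>lp 2. lp_norm 2 u \<le> K * lp_norm 2 (shifted T z u))}"

definition op_spectrum :: "seq_op \<Rightarrow> complex set"
  where "op_spectrum T = - resolvent_set T"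

definition is_eigenvalue :: "seq_op \<Rightarrow> complex \<Rightarrow> bool"
  where "is_eigenvalue T z \<longleftrightarrow> (\<exists>u\<in>lp 2. u \<noteq> 0 \<and> shifted T z u = 0)"

definition root_space :: "seq_op \<Rightarrow> complex \<Rightarrow> (int \<Rightarrow> complex) set"
  where "root_space T z = {u \<in> lp 2. \<exists>k. (shifted T z ^^ k) u = 0}"

text \<open>The algebraic multiplicity is the dimension of the root space (for an isolated spectral point
  outside the essential spectrum this is the rank of the Riesz projection). As \<open>cseq.dim\<close> is \<open>0\<close>
  for infinite-dimensional spaces, finiteness is required separately.\<close>

definition alg_mult :: "seq_op \<Rightarrow> complex \<Rightarrow> nat"
  where "alg_mult T z = cseq.dim (root_space T z)"

definition finite_alg_mult :: "seq_op \<Rightarrow> complex \<Rightarrow> bool"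
  where "finite_alg_mult T z \<longleftrightarrow> (\<exists>B. finite B \<and> root_space T z \<subseteq> cseq.span B)"

definition discrete_spectrum :: "seq_op \<Rightarrow> complex set"
  where "discrete_spectrum T =
    {z. z isolated_in op_spectrum T \<and> is_eigenvalue T z \<and> finite_alg_mult T z}"

definition jacobi :: "(int \<Rightarrow> complex) \<Rightarrow> (int \<Rightarrow> complex) \<Rightarrow> (int \<Rightarrow> complex) \<Rightarrow> seq_op"
  where "jacobi a b c u = (\<lambda>n. a (n - 1) * u (n - 1) + b n * u n + c n * u (n + 1))"

definition jacobi_v ::
  "(int \<Rightarrow> complex) \<Rightarrow> (int \<Rightarrow> complex) \<Rightarrow> (int \<Rightarrow> complex) \<Rightarrow> int \<Rightarrow> real"
  where "jacobi_v a b c n =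
    Max {cmod (a (n - 1) - 1), cmod (a n - 1), cmod (b n), cmod (c (n - 1) - 1), cmod (c n - 1)}"

text \<open>The coefficients of the Jacobi operators over which the supremum is taken.\<close>

definition jacobi_coeffs ::
  "real \<Rightarrow> ((int \<Rightarrow> complex) \<times> (int \<Rightarrow> complex) \<times> (int \<Rightarrow> complex)) set"
  where "jacobi_coeffs p = {(a, b, c). bounded (range a) \<and> bounded (range b) \<and> bounded (range c) \<and>
    jacobi_v a b c \<noteq> 0 \<and> jacobi_v a b c \<in> lp p}"

abbreviation cut :: "complex set"
  where "cut \<equiv> closed_segment (- 2) 2"

definition eigenvalue_weight :: "real \<Rightarrow> (real \<Rightarrow> real) \<Rightarrow> complex \<Rightarrow> real"
  where "eigenvalue_weight p f z =
    infdist z cut powr p / cmod (z\<^sup>2 - 4) powr (1 / 2) *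
    f (- ln (infdist z cut / infdist z {- 2, 2}))"

text \<open>The sum takes values in the extended reals, since it may diverge.\<close>

definition eigenvalue_sum :: "real \<Rightarrow> (real \<Rightarrow> real) \<Rightarrow> seq_op \<Rightarrow> ereal"
  where "eigenvalue_sum p f T =
    (\<Sum>\<^sub>\<infinity>z\<in>discrete_spectrum T. ereal (real (alg_mult T z) * eigenvalue_weight p f z))"

end

theory Submission
  imports Defs
begin

text \<open>The supremum on the left-hand side is infinite for every admissible \<open>f\<close>, so that the asserted
  bound holds with any constant; \<open>C = 1\<close> and \<open>nstar = 2\<close> are used below.

  To see this, fix \<open>M\<close>, put \<open>h = 4\<^sup>-\<^sup>M\<close>, and take \<open>N\<close> with \<open>N + 1 = 2\<^sup>a\<^sup>+\<^sup>M\<close>. Start from the free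
  operator (\<open>a = c = 1\<close>, \<open>b = 0\<close>), add the constant potential \<open>\<i> h\<close> on the sites \<open>1, \<dots>, N\<close>, and cut the two bonds that
  join these sites to the rest, i.e. replace the corresponding off-diagonal entries by \<open>0\<close>. The
  operator is then the direct sum of two free half-line operators and a finite block with the explicit
  eigenvalues \<open>2 cos \<theta>\<^sub>j + \<i> h\<close>, where \<open>\<theta>\<^sub>j = \<pi> j / (N + 1)\<close> and \<open>1 \<le> j \<le> N\<close>. Cutting
  the bonds contributes at most \<open>4\<close> to \<open>\<parallel>v\<parallel>\<^sub>p\<^sup>p \<le> 4 + N h\<^sup>p\<close>, which is negligible once \<open>N h\<^sup>p\<close> is
  large enough (lemma \<open>block_v_lp\<close>).

  These numbers belong to the discrete spectrum (lemma \<open>block_op_eigenvalue_discrete\<close>). For non-real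
  \<open>z = k + 1/k\<close> with \<open>\<bar>k\<bar> < 1\<close>, the free half-line operator minus \<open>z\<close> equals
  \<open>- (1 - k S\<^sup>*) (1 - k S) / k\<close> with the unilateral shift \<open>S\<close>, and both factors are boundedly invertible.
  The block minus \<open>z\<close> is invertible unless a Chebyshev polynomial vanishes at \<open>z - \<i> h\<close>. Hence the
  non-real spectrum is finite, and root vectors for non-real \<open>z\<close> live on the block, so the algebraic
  multiplicities are finite.

  If \<open>\<theta>\<^sub>j \<ge> \<surd>h\<close>, the weight of the \<open>j\<close>-th eigenvalue is at least
  \<open>h\<^sup>p / (4 \<theta>\<^sub>j) \<cdot> f (ln (2 \<theta>\<^sub>j\<^sup>2 / h))\<close> (lemma \<open>eigenvalue_weight_ge\<close>). In each dyadic range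
  \<open>2\<^sup>a\<^sup>+\<^sup>i \<le> j < 2\<^sup>a\<^sup>+\<^sup>i\<^sup>+\<^sup>1\<close> with \<open>i < M\<close> the number of eigenvalues compensates the factor \<open>1 / \<theta>\<^sub>j\<close>, and
  the range contributes at least \<open>h\<^sup>p (N + 1) / 32 \<cdot> f (7 + 2 i)\<close>. After division by
  \<open>\<parallel>v\<parallel>\<^sub>p\<^sup>p \<le> 2 h\<^sup>p (N + 1)\<close> there remains \<open>\<Sum>i<M. f (7 + 2 i)\<close> up to the factor \<open>1/64\<close>, and these sums
  are unbounded because \<open>f\<close> is non-increasing with divergent integral.\<close>

section \<open>The free half-line operator\<close>

lemma Joukowski_obtain:
  fixes z :: complex
  assumes "Im z \<noteq> 0"
  obtains k where "k \<noteq> 0" "cmod k < 1" "z = k + 1 / k"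
proof -
  define s where "s = csqrt (z\<^sup>2 - 4)"
  have s: "s\<^sup>2 = z\<^sup>2 - 4" by (simp add: s_def)
  define k where "k = (z + s) / 2"
  define l where "l = (z - s) / 2"
  have "k * l = (z\<^sup>2 - s\<^sup>2) / 4" by (simp add: k_def l_def power2_eq_square field_simps)
  hence kl: "k * l = 1" by (simp add: s)
  hence nz: "k \<noteq> 0" "l \<noteq> 0" by auto
  have zs: "z = k + l" by (simp add: k_def l_def field_simps)
  have lk: "l = 1 / k" "k = 1 / l" using kl nz by (auto simp: field_simps)
  have "cmod k \<noteq> 1"
  proof
    assume "cmod k = 1"
    hence "k * cnj k = 1" using complex_norm_square[of k] by simp
    hence "inverse k = cnj k" by (rule inverse_unique)
    hence "z = k + cnj k" using zs lk(1) by (simp add: inverse_eq_divide)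
    thus False using assms by simp
  qed
  moreover have "cmod l = 1 / cmod k" by (simp add: lk(1) norm_divide)
  ultimately have "cmod k < 1 \<or> cmod l < 1"
    by (cases "cmod k < 1") (auto simp: divide_less_eq)
  thus thesis using that[of k] that[of l] nz zs lk by (metis add.commute)
qed

text \<open>With \<open>q = \<bar>k\<bar> < 1\<close> this contraction inequality turns the first-order recursions below into
  square-sum bounds.\<close>

lemma norm_scaled_add_square_le:
  fixes k x y :: complex
  assumes "cmod k < 1"
  shows "(cmod (k * x + y))\<^sup>2 \<le> cmod k * (cmod x)\<^sup>2 + (cmod y)\<^sup>2 / (1 - cmod k)"
proof -
  define q A B where "q = cmod k" and "A = cmod x" and "B = cmod y"
  have q: "0 \<le> q" "q < 1" using assms by (auto simp: q_def)
  have "cmod (k * x + y) \<le> q * A + B"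
    unfolding q_def A_def B_def by (metis norm_mult norm_triangle_ineq)
  hence "(cmod (k * x + y))\<^sup>2 \<le> (q * A + B)\<^sup>2" by (rule power_mono) simp
  also have "\<dots> \<le> q * A\<^sup>2 + B\<^sup>2 / (1 - q)"
  proof -
    have "(1 - q) * (q * A + B)\<^sup>2 + q * ((1 - q) * A - B)\<^sup>2 = (1 - q) * (q * A\<^sup>2) + B\<^sup>2"
      by (simp add: power2_eq_square algebra_simps)
    moreover have "q * ((1 - q) * A - B)\<^sup>2 \<ge> 0" using q by simp
    ultimately have "(1 - q) * (q * A + B)\<^sup>2 \<le> (1 - q) * (q * A\<^sup>2) + B\<^sup>2" by linarith
    thus ?thesis using q by (simp add: field_simps)
  qed
  finally show ?thesis by (simp add: q_def A_def B_def)
qed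

lemma half_line_free_injective:
  fixes u :: "nat \<Rightarrow> complex"
  assumes k: "k \<noteq> 0" "cmod k < 1" and z: "z = k + 1 / k"
    and u0: "u 1 = z * u 0" and rec: "\<And>i. u (i + 2) + u i = z * u (i + 1)"
    and bdd: "\<And>i. cmod (u i) \<le> B"
  shows "u i = 0"
proof -
  \<comment> \<open>The differences \<open>u (i + 1) - k * u i\<close> grow like \<open>k\<close> to the power \<open>- i\<close>, which is
    impossible for bounded \<open>u\<close> unless they vanish.\<close>
  have step: "k ^ (i + 1) * (u (i + 1) - k * u i) = u 0" for i
  proof (induction i)
    case 0
    show ?case using u0 k by (simp add: z field_simps)
  next
    case (Suc i)
    have "k * (u (i + 2) - k * u (i + 1)) = k * ((z - k) * u (i + 1) - u i)"
    proof -
      have "u (i + 2) = z * u (i + 1) - u i" using rec[of i] by (metis add_diff_cancel_right')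
      thus ?thesis by (simp add: left_diff_distrib)
    qed
    also have "\<dots> = u (i + 1) - k * u i" using k by (simp add: z field_simps)
    finally have "k * (u (i + 2) - k * u (i + 1)) = u (i + 1) - k * u i" .
    hence "k ^ (i + 1) * (k * (u (i + 2) - k * u (i + 1))) = u 0" using Suc by simp
    thus ?case by (simp add: mult_ac)
  qed
  have "(\<lambda>i. cmod k ^ (i + 1) * (2 * B)) \<longlonglongrightarrow> 0 * (2 * B)"
    by (intro tendsto_mult tendsto_const LIMSEQ_ignore_initial_segment LIMSEQ_power_zero) (use k in auto)
  moreover have "cmod (u 0) \<le> cmod k ^ (i + 1) * (2 * B)" for i
  proof -
    have "cmod (u (i + 1) - k * u i) \<le> cmod (u (i + 1)) + cmod k * cmod (u i)"
      by (metis norm_mult norm_triangle_ineq4)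
    also have "\<dots> \<le> B + 1 * B"
      using bdd k by (intro add_mono mult_mono) auto
    finally have "cmod k ^ (i + 1) * cmod (u (i + 1) - k * u i) \<le> cmod k ^ (i + 1) * (2 * B)"
      by (intro mult_left_mono) auto
    thus ?thesis using step[of i] by (metis norm_mult norm_power)
  qed
  ultimately have "cmod (u 0) \<le> 0 * (2 * B)"
    by (intro LIMSEQ_le_const) auto
  hence "u 0 = 0" by simp
  moreover have "u (i + 1) = k * u i" for i using step[of i] \<open>u 0 = 0\<close> k by simp
  ultimately show ?thesis by (induction i) auto
qed

text \<open>Square-summability is expressed by bounds on all partial sums. The solution \<open>u\<close> is found in two
  steps from the factorization: \<open>y i - k * y (i + 1) = - k * w i\<close> is solved by a series, and
  \<open>u (i + 1) - k * u i = y (i + 1)\<close>, \<open>u 0 = y 0\<close> by recursion.\<close>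

lemma half_line_free_solvable:
  fixes k z :: complex
  assumes k: "k \<noteq> 0" "cmod k < 1" and z: "z = k + 1 / k"
  obtains K :: real where "K \<ge> 0" and
    "\<And>w W. (\<And>n. (\<Sum>i<n. (cmod (w i))\<^sup>2) \<le> W) \<Longrightarrow>
      \<exists>u :: nat \<Rightarrow> complex. u 1 - z * u 0 = w 0 \<and> (\<forall>i. u (i + 2) + u i - z * u (i + 1) = w (i + 1)) \<and>
          (\<forall>n. (\<Sum>i<n. (cmod (u i))\<^sup>2) \<le> K * W)"
proof -
  define q where "q = cmod k"
  have q: "0 < q" "q < 1" using k by (auto simp: q_def)
  define K1 where "K1 = (q / (1 - q)\<^sup>2 + 1 / (1 - q)) / (1 - q)"
  define K where "K = K1 / (1 - q) / (1 - q)"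
  have K1: "K1 \<ge> 0" using q by (simp add: K1_def)
  hence "K \<ge> 0" using q by (simp add: K_def)
  moreover have "\<exists>u :: nat \<Rightarrow> complex. u 1 - z * u 0 = w 0 \<and> (\<forall>i. u (i + 2) + u i - z * u (i + 1) = w (i + 1)) \<and>
          (\<forall>n. (\<Sum>i<n. (cmod (u i))\<^sup>2) \<le> K * W)"
    if W: "\<And>n. (\<Sum>i<n. (cmod (w i))\<^sup>2) \<le> W" for w :: "nat \<Rightarrow> complex" and W
  proof -
    have W0: "W \<ge> 0" using W[of 0] by simp
    have w: "cmod (w i) \<le> sqrt W" for i
    proof (rule real_le_rsqrt)
      have "(cmod (w i))\<^sup>2 \<le> (\<Sum>j<Suc i. (cmod (w j))\<^sup>2)" by (simp add: sum_nonneg)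
      thus "(cmod (w i))\<^sup>2 \<le> W" using W[of "Suc i"] by linarith
    qed
    have geo: "summable (\<lambda>j. q ^ (j + 1) * sqrt W)"
      by (intro summable_mult2 summable_ignore_initial_segment summable_geometric) (use q in auto)
    have smn: "summable (\<lambda>j. cmod (k ^ (j + 1) * w (i + j)))" for i
      by (rule summable_comparison_test'[OF geo])
         (auto simp: norm_mult norm_power q_def intro!: mult_left_mono w)
    hence sm: "summable (\<lambda>j. k ^ (j + 1) * w (i + j))" for i
      by (rule summable_norm_cancel)
    define y where "y i = - (\<Sum>j. k ^ (j + 1) * w (i + j))" for i
    have y: "y i = k * y (i + 1) + - (k * w i)" for i
    proof -
      have "(\<Sum>j. k ^ (j + 1) * w (i + j)) =
          (\<Sum>j. k ^ (Suc j + 1) * w (i + Suc j)) + k ^ (0 + 1) * w (i + 0)"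
        using suminf_split_head[OF sm[of i]] by simp
      also have "(\<Sum>j. k ^ (Suc j + 1) * w (i + Suc j)) = (\<Sum>j. k * (k ^ (j + 1) * w (i + 1 + j)))"
        by (simp add: mult_ac)
      also have "\<dots> = k * (\<Sum>j. k ^ (j + 1) * w (i + 1 + j))" by (rule suminf_mult[OF sm])
      finally show ?thesis by (simp add: y_def)
    qed
    \<comment> \<open>An a priori bound on \<open>y\<close> is needed, since its recursion runs backwards and the partial sum
      up to \<open>n\<close> involves \<open>y n\<close>.\<close>
    have ybd: "cmod (y i) \<le> sqrt W / (1 - q)" for i
    proof -
      have "cmod (y i) \<le> (\<Sum>j. cmod (k ^ (j + 1) * w (i + j)))"
        unfolding y_def norm_minus_cancel by (rule summable_norm[OF smn])
      also have "\<dots> \<le> (\<Sum>j. q ^ (j + 1) * sqrt W)"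
        by (intro suminf_le smn geo) (auto simp: norm_mult norm_power q_def intro!: mult_left_mono w)
      also have "\<dots> = (\<Sum>j. q * sqrt W * q ^ j)" by (simp add: mult_ac)
      also have "\<dots> = q * sqrt W * (1 / (1 - q))"
        using q by (subst suminf_mult) (auto simp: suminf_geometric intro!: summable_geometric)
      also have "\<dots> \<le> 1 * sqrt W * (1 / (1 - q))"
        using q W0 by (intro mult_right_mono) auto
      finally show ?thesis by simp
    qed
    have ysum: "(\<Sum>i<n. (cmod (y i))\<^sup>2) \<le> K1 * W" for n
    proof -
      define S where "S = (\<Sum>i<n. (cmod (y i))\<^sup>2)"
      have "S \<le> (\<Sum>i<n. q * (cmod (y (Suc i)))\<^sup>2 + (cmod (w i))\<^sup>2 / (1 - q))"
        unfolding S_def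
      proof (rule sum_mono)
        fix i
        have "(cmod (y i))\<^sup>2 \<le> q * (cmod (y (i + 1)))\<^sup>2 + (cmod (- (k * w i)))\<^sup>2 / (1 - q)"
          unfolding q_def by (subst y) (rule norm_scaled_add_square_le[OF k(2)])
        also have "(cmod (- (k * w i)))\<^sup>2 \<le> (cmod (w i))\<^sup>2"
          using k by (intro power_mono) (auto simp: norm_mult intro!: mult_left_le_one_le)
        finally show "(cmod (y i))\<^sup>2 \<le> q * (cmod (y (Suc i)))\<^sup>2 + (cmod (w i))\<^sup>2 / (1 - q)"
          using q by (simp add: divide_right_mono)
      qed
      also have "\<dots> = q * (\<Sum>i<n. (cmod (y (Suc i)))\<^sup>2) + (\<Sum>i<n. (cmod (w i))\<^sup>2) / (1 - q)"
        by (simp add: sum.distrib sum_distrib_left sum_divide_distrib)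
      also have "(\<Sum>i<n. (cmod (y (Suc i)))\<^sup>2) \<le> S + (cmod (y n))\<^sup>2"
        using sum.lessThan_Suc_shift[of "\<lambda>i. (cmod (y i))\<^sup>2" n] by (simp add: S_def)
      also have "(cmod (y n))\<^sup>2 \<le> W / (1 - q)\<^sup>2"
        using power_mono[OF ybd[of n], of 2] W0 by (simp add: power_divide)
      also have "(\<Sum>i<n. (cmod (w i))\<^sup>2) \<le> W" by (rule W)
      finally have "S \<le> q * (S + W / (1 - q)\<^sup>2) + W / (1 - q)"
        using q by (simp add: divide_right_mono mult_left_mono)
      hence "S * (1 - q) \<le> (q / (1 - q)\<^sup>2 + 1 / (1 - q)) * W" by (simp add: algebra_simps)
      hence "S \<le> (q / (1 - q)\<^sup>2 + 1 / (1 - q)) * W / (1 - q)"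
        using q by (subst pos_le_divide_eq) auto
      thus ?thesis by (simp add: K1_def S_def)
    qed
    define u where "u = rec_nat (y 0) (\<lambda>i x. k * x + y (Suc i))"
    have u0: "u 0 = y 0" and us: "u (Suc i) = k * u i + y (Suc i)" for i
      by (simp_all add: u_def)
    have usum: "(\<Sum>i<n. (cmod (u i))\<^sup>2) \<le> K * W" for n
    proof -
      define S where "S n = (\<Sum>i<n. (cmod (u i))\<^sup>2)" for n
      have S0: "S n \<ge> 0" for n by (simp add: S_def sum_nonneg)
      have "S n \<le> S (Suc n)" by (simp add: S_def)
      also have "S (Suc n) = (cmod (y 0))\<^sup>2 + (\<Sum>i<n. (cmod (u (Suc i)))\<^sup>2)"
        unfolding S_def by (simp add: sum.lessThan_Suc_shift u0 del: sum.lessThan_Suc)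
      also have "(\<Sum>i<n. (cmod (u (Suc i)))\<^sup>2) \<le>
          (\<Sum>i<n. q * (cmod (u i))\<^sup>2 + (cmod (y (Suc i)))\<^sup>2 / (1 - q))"
        unfolding us q_def by (intro sum_mono norm_scaled_add_square_le k)
      also have "\<dots> = q * S n + (\<Sum>i<n. (cmod (y (Suc i)))\<^sup>2) / (1 - q)"
        by (simp add: S_def sum.distrib sum_distrib_left sum_divide_distrib)
      also have "(cmod (y 0))\<^sup>2 \<le> (cmod (y 0))\<^sup>2 / (1 - q)"
        using q by (simp add: field_simps mult_left_le)
      finally have "S n \<le> q * S n + (\<Sum>i<Suc n. (cmod (y i))\<^sup>2) / (1 - q)"
        by (simp add: sum.lessThan_Suc_shift add_divide_distrib del: sum.lessThan_Suc)
      also have "(\<Sum>i<Suc n. (cmod (y i))\<^sup>2) / (1 - q) \<le> K1 * W / (1 - q)"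
        using q by (intro divide_right_mono ysum) auto
      finally have "S n * (1 - q) \<le> K1 * W / (1 - q)" by (simp add: algebra_simps)
      hence "S n \<le> K1 * W / (1 - q) / (1 - q)" using q by (subst pos_le_divide_eq) auto
      thus ?thesis by (simp add: K_def S_def)
    qed
    have yk: "y (i + 1) = y i / k + w i" for i using y[of i] k by (simp add: field_simps)
    have "u 1 - z * u 0 = w 0"
      using yk[of 0] us[of 0] u0 by (simp add: z algebra_simps)
    moreover have "u (i + 2) + u i - z * u (i + 1) = w (i + 1)" for i
    proof -
      have "u (i + 2) = k * u (i + 1) + (u (i + 1) - k * u i) / k + w (i + 1)"
        using us[of "i + 1"] us[of i] yk[of "i + 1"] by simp
      thus ?thesis using k by (simp add: z field_simps)
    qed
    ultimately show ?thesis using usum by blast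
  qed
  ultimately show thesis using that by blast
qed

section \<open>The finite block\<close>

text \<open>\<open>cheb n\<close> is the Chebyshev polynomial of the second kind in the normalization \<open>U\<^sub>n\<^sub>-\<^sub>1 (x / 2)\<close>: the
  solution of \<open>u (n + 2) + u n = x * u (n + 1)\<close> with \<open>u 0 = 0\<close> and \<open>u 1 = 1\<close>.\<close>

fun cheb :: "nat \<Rightarrow> complex poly" where
  "cheb 0 = 0"
| "cheb (Suc 0) = 1"
| "cheb (Suc (Suc n)) = [:0, 1:] * cheb (Suc n) - cheb n"

lemma poly_cheb_2: "poly (cheb n) 2 = of_nat n"
  by (induction n rule: cheb.induct) (auto simp: algebra_simps)

lemma finite_cheb_roots: "finite {x. poly (cheb (Suc n)) x = 0}"
  using poly_cheb_2[of "Suc n"] by (intro poly_roots_finite) (auto simp del: cheb.simps of_nat_Suc)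

text \<open>The kernel equation on a block determines \<open>u\<close> by \<open>u 1\<close>.\<close>

lemma cheb_recurrence_unique:
  fixes u :: "nat \<Rightarrow> complex"
  assumes u0: "u 0 = 0" and rec: "\<And>i. i < N \<Longrightarrow> u (i + 2) + u i = x * u (i + 1)"
    and i: "i \<le> Suc N"
  shows "u i = u 1 * poly (cheb i) x"
  using i
proof (induction i rule: cheb.induct)
  case (3 n)
  have "u (Suc (Suc n)) = x * u (Suc n) - u n" using rec[of n] 3 by (simp add: algebra_simps)
  thus ?case using 3 by (simp add: algebra_simps)
qed (auto simp: u0)

text \<open>The inhomogeneous equation is solved with \<open>u 0 = u 1 = 0\<close> by recursion; a multiple of \<open>cheb\<close>
  is then subtracted to satisfy the boundary condition at \<open>N + 1\<close>.\<close>

lemma dirichlet_block_solvable: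
  assumes nz: "poly (cheb (Suc N)) x \<noteq> 0"
  obtains K :: real where "K \<ge> 0" and
    "\<And>w W. (\<And>i. i < N \<Longrightarrow> cmod (w (i + 1)) \<le> W) \<Longrightarrow> W \<ge> 0 \<Longrightarrow>
      \<exists>u. u 0 = 0 \<and> u (Suc N) = 0 \<and> (\<forall>i<N. u (i + 2) + u i - x * u (i + 1) = w (i + 1)) \<and>
          (\<forall>i\<le>N. cmod (u i) \<le> K * W)"
proof -
  define D where "D = cmod x + 2"
  have D: "D \<ge> 1" by (simp add: D_def)
  define M where "M = (\<Sum>i\<le>N. cmod (poly (cheb i) x))"
  define K where "K = D ^ Suc N + D ^ Suc N / cmod (poly (cheb (Suc N)) x) * M"
  have M: "M \<ge> 0" by (simp add: M_def sum_nonneg)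
  have "K \<ge> 0" using D M by (auto simp: K_def intro!: add_nonneg_nonneg mult_nonneg_nonneg divide_nonneg_nonneg)
  moreover have "\<exists>u. u 0 = 0 \<and> u (Suc N) = 0 \<and>
        (\<forall>i<N. u (i + 2) + u i - x * u (i + 1) = w (i + 1)) \<and> (\<forall>i\<le>N. cmod (u i) \<le> K * W)"
    if w: "\<And>i. i < N \<Longrightarrow> cmod (w (i + 1)) \<le> W" and W: "W \<ge> 0" for w :: "nat \<Rightarrow> complex" and W
  proof -
    define pp where "pp = rec_nat (0, 0) (\<lambda>i (s, t). (t, x * t - s + w (i + 1)))"
    define p where "p i = fst (pp i)" for i
    have pp: "snd (pp i) = p (Suc i)" for i by (simp add: pp_def p_def case_prod_beta)
    have p0: "p 0 = 0" "p (Suc 0) = 0" by (simp_all add: p_def pp_def)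
    have p2: "p (Suc (Suc i)) = x * p (Suc i) - p i + w (i + 1)" for i
    proof -
      have "p (Suc (Suc i)) = snd (pp (Suc i))" by (simp add: pp)
      also have "\<dots> = x * snd (pp i) - fst (pp i) + w (i + 1)" by (simp add: pp_def case_prod_beta)
      finally show ?thesis by (simp add: pp p_def)
    qed
    have pb: "cmod (p i) \<le> D ^ i * W" if "i \<le> Suc N" for i
      using that
    proof (induction i rule: cheb.induct)
      case (3 i)
      have "cmod (p (Suc (Suc i))) \<le> cmod x * cmod (p (Suc i)) + cmod (p i) + cmod (w (i + 1))"
        unfolding p2 by (metis (no_types, lifting) add_right_mono norm_mult norm_triangle_ineq
          norm_triangle_ineq4 order_trans)
      also have "\<dots> \<le> cmod x * (D ^ Suc i * W) + D ^ i * W + W"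
        using 3 by (intro add_mono mult_left_mono w) auto
      also have "\<dots> \<le> cmod x * (D ^ Suc i * W) + D ^ Suc i * W + D ^ Suc i * W"
        using D W power_increasing[of i "Suc i" D] one_le_power[of D "Suc i"]
        by (intro add_mono mult_right_mono order_refl mult_right_mono[of 1 _ W, simplified]) auto
      also have "\<dots> = D ^ Suc (Suc i) * W" by (simp add: D_def algebra_simps)
      finally show ?case .
    qed (use W D p0 in auto)
    define r where "r = p (Suc N) / poly (cheb (Suc N)) x"
    define u where "u i = p i - r * poly (cheb i) x" for i
    have "u 0 = 0" by (simp add: u_def p0)
    moreover have "u (Suc N) = 0" using nz by (simp add: u_def r_def del: cheb.simps)
    moreover have "u (i + 2) + u i - x * u (i + 1) = w (i + 1)" for i
      using p2[of i] by (simp add: u_def algebra_simps)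
    moreover have "cmod (u i) \<le> K * W" if "i \<le> N" for i
    proof -
      have "cmod (u i) \<le> cmod (p i) + cmod r * cmod (poly (cheb i) x)"
        unfolding u_def by (metis norm_mult norm_triangle_ineq4)
      also have "cmod (p i) \<le> D ^ Suc N * W"
        using pb[of i] that D W power_increasing[of i "Suc N" D]
        by (meson le_Suc_eq mult_right_mono order_trans)
      also have "cmod r * cmod (poly (cheb i) x) \<le> D ^ Suc N * W / cmod (poly (cheb (Suc N)) x) * M"
      proof (rule mult_mono)
        show "cmod r \<le> D ^ Suc N * W / cmod (poly (cheb (Suc N)) x)"
          unfolding r_def norm_divide using pb[of "Suc N"] by (intro divide_right_mono) auto
        show "cmod (poly (cheb i) x) \<le> M"
          unfolding M_def
          by (rule member_le_sum[of i "{..N}" "\<lambda>i. cmod (poly (cheb i) x)"]) (use that in auto)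
        show "0 \<le> D ^ Suc N * W / cmod (poly (cheb (Suc N)) x)" using D W by simp
      qed simp
      finally show ?thesis by (simp add: K_def algebra_simps)
    qed
    ultimately show ?thesis by blast
  qed
  ultimately show thesis using that by blast
qed

section \<open>Square-summable sequences and resolvents of Jacobi operators\<close>

lemma lp_2_boundI:
  fixes u :: "int \<Rightarrow> complex"
  assumes "\<And>F. finite F \<Longrightarrow> (\<Sum>n\<in>F. (cmod (u n))\<^sup>2) \<le> C"
  shows "u \<in> lp 2" and "lp_norm 2 u \<le> sqrt C"
proof -
  have s: "(\<lambda>n. (cmod (u n))\<^sup>2) summable_on UNIV"
    by (rule nonneg_bdd_above_summable_on) (auto intro!: bdd_aboveI2 assms)
  show "u \<in> lp 2" using s by (simp add: lp_def)
  have "(\<Sum>\<^sub>\<infinity>n. (cmod (u n))\<^sup>2) \<le> C"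
    by (rule infsum_le_finite_sums[OF s]) (use assms in auto)
  thus "lp_norm 2 u \<le> sqrt C"
    by (simp add: lp_norm_def powr_half_sqrt infsum_nonneg)
qed

lemma lp_2_sum_le:
  fixes u :: "int \<Rightarrow> complex"
  assumes "u \<in> lp 2" "finite F"
  shows "(\<Sum>n\<in>F. (cmod (u n))\<^sup>2) \<le> (lp_norm 2 u)\<^sup>2"
proof -
  have "(\<Sum>n\<in>F. (cmod (u n))\<^sup>2) \<le> (\<Sum>\<^sub>\<infinity>n. (cmod (u n))\<^sup>2)"
    by (rule finite_sum_le_infsum) (use assms in \<open>auto simp: lp_def\<close>)
  thus ?thesis by (simp add: lp_norm_def powr_half_sqrt infsum_nonneg)
qed

lemma lp_norm_nonneg: "0 \<le> lp_norm p u"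
  by (simp add: lp_norm_def)

lemma lp_2_norm_le:
  fixes u :: "int \<Rightarrow> complex"
  assumes "u \<in> lp 2"
  shows "cmod (u n) \<le> lp_norm 2 u"
  using lp_2_sum_le[OF assms, of "{n}"] by (auto intro: power2_le_imp_le lp_norm_nonneg)

lemma lp_2_sum_reindex_le:
  fixes u :: "int \<Rightarrow> complex"
  assumes "u \<in> lp 2" "finite A" "inj_on g A"
  shows "(\<Sum>i\<in>A. (cmod (u (g i)))\<^sup>2) \<le> (lp_norm 2 u)\<^sup>2"
  using lp_2_sum_le[OF assms(1), of "g ` A"] assms by (simp add: sum.reindex o_def)

lemma lp_2_diff:
  fixes u w :: "int \<Rightarrow> complex"
  assumes "u \<in> lp 2" "w \<in> lp 2"
  shows "u - w \<in> lp 2"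
proof (rule lp_2_boundI)
  fix F :: "int set" assume F: "finite F"
  have "(cmod (x - y))\<^sup>2 \<le> 2 * (cmod x)\<^sup>2 + 2 * (cmod y)\<^sup>2" for x y
  proof -
    have "(cmod (x - y))\<^sup>2 \<le> (cmod x + cmod y)\<^sup>2"
      by (intro power_mono norm_triangle_ineq4) simp
    also have "\<dots> \<le> 2 * (cmod x)\<^sup>2 + 2 * (cmod y)\<^sup>2"
      using zero_le_power2[of "cmod x - cmod y"] by (simp add: power2_eq_square algebra_simps)
    finally show ?thesis .
  qed
  hence "(\<Sum>n\<in>F. (cmod ((u - w) n))\<^sup>2) \<le> (\<Sum>n\<in>F. 2 * (cmod (u n))\<^sup>2 + 2 * (cmod (w n))\<^sup>2)"
    by (intro sum_mono) simp
  also have "\<dots> = 2 * (\<Sum>n\<in>F. (cmod (u n))\<^sup>2) + 2 * (\<Sum>n\<in>F. (cmod (w n))\<^sup>2)"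
    by (simp add: sum.distrib sum_distrib_left)
  also have "\<dots> \<le> 2 * (lp_norm 2 u)\<^sup>2 + 2 * (lp_norm 2 w)\<^sup>2"
    using lp_2_sum_le[OF assms(1) F] lp_2_sum_le[OF assms(2) F] by simp
  finally show "(\<Sum>n\<in>F. (cmod ((u - w) n))\<^sup>2) \<le> 2 * (lp_norm 2 u)\<^sup>2 + 2 * (lp_norm 2 w)\<^sup>2" .
qed

lemma shifted_jacobi_in_lp_2:
  assumes bdd: "bounded (range a)" "bounded (range b)" "bounded (range c)" and u: "u \<in> lp 2"
  shows "shifted (jacobi a b c) z u \<in> lp 2"
proof -
  obtain A B C where ABC: "\<And>n. cmod (a n) \<le> A" "\<And>n. cmod (b n) \<le> B" "\<And>n. cmod (c n) \<le> C"
    using bdd unfolding bounded_iff by (metis rangeI)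
  define M where "M = A + B + C + cmod z"
  have nn: "A \<ge> 0" "B \<ge> 0" "C \<ge> 0" using ABC norm_ge_zero order_trans by blast+
  have *: "(cmod (shifted (jacobi a b c) z u n))\<^sup>2
      \<le> 3 * M\<^sup>2 * ((cmod (u (n - 1)))\<^sup>2 + (cmod (u n))\<^sup>2 + (cmod (u (n + 1)))\<^sup>2)" for n
  proof -
    define x y w where "x = cmod (u (n - 1))" and "y = cmod (u n)" and "w = cmod (u (n + 1))"
    have "shifted (jacobi a b c) z u n = a (n - 1) * u (n - 1) + (b n - z) * u n + c n * u (n + 1)"
      by (simp add: shifted_def jacobi_def algebra_simps)
    hence "cmod (shifted (jacobi a b c) z u n)
        \<le> cmod (a (n - 1)) * x + cmod (b n - z) * y + cmod (c n) * w"
      unfolding x_def y_def w_def norm_mult[symmetric] by (simp add: norm_triangle_le norm_triangle_mono)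
    also have "\<dots> \<le> M * x + M * y + M * w"
    proof (intro add_mono mult_right_mono)
      show "cmod (b n - z) \<le> M"
        using norm_triangle_ineq4[of "b n" z] ABC(2)[of n] nn by (simp add: M_def)
    qed (use ABC(1)[of "n - 1"] ABC(3)[of n] nn in \<open>auto simp: M_def x_def y_def w_def
           intro!: add_nonneg_nonneg intro: order_trans\<close>)
    finally have "(cmod (shifted (jacobi a b c) z u n))\<^sup>2 \<le> (M * (x + y + w))\<^sup>2"
      by (intro power_mono) (auto simp: algebra_simps)
    also have "\<dots> = M\<^sup>2 * (x + y + w)\<^sup>2" by (simp add: power_mult_distrib)
    also have "(x + y + w)\<^sup>2 \<le> 3 * (x\<^sup>2 + y\<^sup>2 + w\<^sup>2)"
      using zero_le_power2[of "x - y"] zero_le_power2[of "x - w"] zero_le_power2[of "y - w"]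
      by (simp add: power2_eq_square algebra_simps)
    finally show ?thesis by (simp add: x_def y_def w_def mult_left_mono mult.assoc mult.left_commute[of 3])
  qed
  show ?thesis
  proof (rule lp_2_boundI)
    fix F :: "int set" assume F: "finite F"
    have "(\<Sum>n\<in>F. (cmod (shifted (jacobi a b c) z u n))\<^sup>2)
        \<le> (\<Sum>n\<in>F. 3 * M\<^sup>2 * ((cmod (u (n - 1)))\<^sup>2 + (cmod (u n))\<^sup>2 + (cmod (u (n + 1)))\<^sup>2))"
      by (intro sum_mono *)
    also have "\<dots> = 3 * M\<^sup>2 * ((\<Sum>n\<in>F. (cmod (u (n - 1)))\<^sup>2) + (\<Sum>n\<in>F. (cmod (u n))\<^sup>2)
        + (\<Sum>n\<in>F. (cmod (u (n + 1)))\<^sup>2))"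
      by (simp add: sum.distrib flip: sum_distrib_left)
    also have "\<dots> \<le> 3 * M\<^sup>2 * ((lp_norm 2 u)\<^sup>2 + (lp_norm 2 u)\<^sup>2 + (lp_norm 2 u)\<^sup>2)"
      by (intro mult_left_mono add_mono lp_2_sum_reindex_le u F lp_2_sum_le) (auto simp: inj_on_def)
    finally show "(\<Sum>n\<in>F. (cmod (shifted (jacobi a b c) z u n))\<^sup>2)
        \<le> 3 * M\<^sup>2 * ((lp_norm 2 u)\<^sup>2 + (lp_norm 2 u)\<^sup>2 + (lp_norm 2 u)\<^sup>2)" .
  qed
qed

lemma jacobi_resolvent_setI:
  assumes bdd: "bounded (range a)" "bounded (range b)" "bounded (range c)"
    and inj: "\<And>u. u \<in> lp 2 \<Longrightarrow> shifted (jacobi a b c) z u = 0 \<Longrightarrow> u = 0"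
    and sol: "\<And>w. w \<in> lp 2 \<Longrightarrow>
      \<exists>u\<in>lp 2. shifted (jacobi a b c) z u = w \<and> lp_norm 2 u \<le> K * lp_norm 2 w"
  shows "z \<in> resolvent_set (jacobi a b c)"
proof -
  let ?S = "shifted (jacobi a b c) z"
  have maps: "?S u \<in> lp 2" if "u \<in> lp 2" for u
    using shifted_jacobi_in_lp_2[OF bdd that] .
  have inj': "inj_on ?S (lp 2)"
  proof (rule inj_onI)
    fix u w assume uw: "u \<in> lp 2" "w \<in> lp 2" "?S u = ?S w"
    have diff: "?S (u - w) = ?S u - ?S w"
      by (auto simp: shifted_def jacobi_def fun_eq_iff algebra_simps)
    have "u - w = 0"
      by (rule inj[OF lp_2_diff[OF uw(1,2)]]) (simp only: diff uw(3) diff_self)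
    thus "u = w" by (simp only: right_minus_eq)
  qed
  moreover have "?S ` lp 2 = lp 2"
    using maps sol by (auto simp: image_iff)
  moreover have "lp_norm 2 u \<le> K * lp_norm 2 (?S u)" if "u \<in> lp 2" for u
    using sol[OF maps[OF that]] inj' that by (metis inj_onD)
  ultimately show ?thesis unfolding resolvent_set_def bij_betw_def by blast
qed

section \<open>The operator with a decoupled block\<close>

text \<open>Off-diagonal entries of the operator used as the example: the bonds between the sites \<open>0, 1\<close> and
  \<open>N, N + 1\<close> are cut, all the others are free. The sequence serves both as \<open>a\<close> and as \<open>c\<close>.\<close>

definition cut_offdiag :: "nat \<Rightarrow> int \<Rightarrow> complex" where
  "cut_offdiag N m = (if m = 0 \<or> m = int N then 0 else 1)"

definition block_potential :: "nat \<Rightarrow> real \<Rightarrow> int \<Rightarrow> complex" where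
  "block_potential N h m = (if 1 \<le> m \<and> m \<le> int N then \<i> * of_real h else 0)"

text \<open>The direct sum of two free half-line operators, on the sites below \<open>1\<close> and above \<open>N\<close>, and of the
  free operator shifted by \<open>\<i> h\<close> on the block \<open>1, \<dots>, N\<close>.\<close>

abbreviation block_op :: "nat \<Rightarrow> real \<Rightarrow> seq_op" where
  "block_op N h \<equiv> jacobi (cut_offdiag N) (block_potential N h) (cut_offdiag N)"

lemma bounded_cut_offdiag: "bounded (range (cut_offdiag N))"
  by (rule boundedI[of _ 1]) (auto simp: cut_offdiag_def)

lemma bounded_block_potential: "bounded (range (block_potential N h))"
  by (rule boundedI[of _ "\<bar>h\<bar>"]) (auto simp: block_potential_def norm_mult)

lemma shifted_block_op_left:
  "shifted (block_op N h) z u 0 = u (-1) - z * u 0"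
  "shifted (block_op N h) z u (- int (Suc i)) =
     u (- int (i + 2)) + u (- int i) - z * u (- int (i + 1))"
  by (auto simp: shifted_def jacobi_def cut_offdiag_def block_potential_def algebra_simps)

lemma shifted_block_op_right:
  "shifted (block_op N h) z u (int N + 1) = u (int N + 1 + int 1) - z * u (int N + 1 + int 0)"
  "shifted (block_op N h) z u (int N + 1 + int (Suc i)) =
     u (int N + 1 + int (i + 2)) + u (int N + 1 + int i) - z * u (int N + 1 + int (i + 1))"
  by (auto simp: shifted_def jacobi_def cut_offdiag_def block_potential_def algebra_simps)

lemma shifted_block_op_inner:
  assumes "1 \<le> m" "m \<le> int N"
  shows "shifted (block_op N h) z u m = (if m = 1 then 0 else u (m - 1)) +
     (if m = int N then 0 else u (m + 1)) - (z - \<i> * of_real h) * u m"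
  using assms by (auto simp: shifted_def jacobi_def cut_offdiag_def block_potential_def algebra_simps)

text \<open>Only the equations outside the block are used, which do not involve the values on the block.\<close>

lemma block_op_kernel_outside:
  assumes z: "Im z \<noteq> 0" and bdd: "\<And>m. cmod (u m) \<le> B"
    and eq: "\<And>m. m < 1 \<or> m > int N \<Longrightarrow> shifted (block_op N h) z u m = 0"
    and m: "m < 1 \<or> m > int N"
  shows "u m = 0"
proof -
  obtain k where k: "k \<noteq> 0" "cmod k < 1" "z = k + 1 / k" using Joukowski_obtain[OF z] .
  have "u (- int i) = 0" for i
  proof (rule half_line_free_injective[OF k, where u = "\<lambda>i. u (- int i)"])
    show "u (- int 1) = z * u (- int 0)"
      using eq[of 0] by (simp add: shifted_block_op_left)
    show "u (- int (i + 2)) + u (- int i) = z * u (- int (i + 1))" for i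
      using eq[of "- int (Suc i)"] unfolding shifted_block_op_left by simp
  qed (rule bdd)
  moreover have "u (int N + 1 + int i) = 0" for i
  proof (rule half_line_free_injective[OF k, where u = "\<lambda>i. u (int N + 1 + int i)"])
    show "u (int N + 1 + int 1) = z * u (int N + 1 + int 0)"
      using eq[of "int N + 1"] unfolding shifted_block_op_right by simp
    show "u (int N + 1 + int (i + 2)) + u (int N + 1 + int i) = z * u (int N + 1 + int (i + 1))" for i
      using eq[of "int N + 1 + int (Suc i)"] unfolding shifted_block_op_right by simp
  qed (rule bdd)
  moreover have "m = - int (nat (- m)) \<or> m = int N + 1 + int (nat (m - int N - 1))" using m by auto
  ultimately show ?thesis by metis
qed

lemma block_op_injective:
  assumes z: "Im z \<noteq> 0" and nz: "poly (cheb (Suc N)) (z - \<i> * of_real h) \<noteq> 0"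
    and bdd: "\<And>m. cmod (u m) \<le> B" and eq: "shifted (block_op N h) z u = 0"
  shows "u = 0"
proof
  fix m
  have outside: "u m = 0" if "m < 1 \<or> m > int N" for m
    by (rule block_op_kernel_outside[where h = h, OF z bdd _ that]) (simp add: eq)
  define x where "x = z - \<i> * of_real h"
  have U: "u (int i) = u (int 1) * poly (cheb i) x" if "i \<le> Suc N" for i
  proof (rule cheb_recurrence_unique[where u = "\<lambda>i. u (int i)" and N = N])
    fix i assume i: "i < N"
    have "shifted (block_op N h) z u (int (Suc i)) = 0" by (simp add: eq)
    moreover have "(if int (Suc i) = 1 then 0 else u (int (Suc i) - 1)) = u (int i)"
      using outside[of 0] by auto
    moreover have "(if int (Suc i) = int N then 0 else u (int (Suc i) + 1)) = u (int (i + 2))"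
      using outside[of "int (i + 2)"] by (auto simp: add.commute)
    ultimately show "u (int (i + 2)) + u (int i) = x * u (int (i + 1))"
      using i by (subst (asm) shifted_block_op_inner) (auto simp: x_def algebra_simps)
  qed (use that outside[of 0] in auto)
  have "u (int (Suc N)) = 0" by (rule outside) simp
  hence "u 1 = 0" using U[of "Suc N"] nz by (simp add: x_def del: cheb.simps)
  hence "u m = 0" if "1 \<le> m" "m \<le> int N" using U[of "nat m"] that by simp
  thus "u m = 0 m" using outside[of m] by fastforce
qed

text \<open>The inverse is put together from the solutions on the left half-line (reflected), on the block,
  and on the right half-line (translated).\<close>

lemma block_op_resolvent_set:
  assumes z: "Im z \<noteq> 0" and nz: "poly (cheb (Suc N)) (z - \<i> * of_real h) \<noteq> 0"
  shows "z \<in> resolvent_set (block_op N h)"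
proof -
  obtain k where k: "k \<noteq> 0" "cmod k < 1" "z = k + 1 / k" using Joukowski_obtain[OF z] .
  obtain K where K: "K \<ge> 0" and half: "\<And>w W. (\<And>n. (\<Sum>i<n. (cmod (w i))\<^sup>2) \<le> W) \<Longrightarrow>
      \<exists>u :: nat \<Rightarrow> complex. u 1 - z * u 0 = w 0 \<and> (\<forall>i. u (i + 2) + u i - z * u (i + 1) = w (i + 1)) \<and>
          (\<forall>n. (\<Sum>i<n. (cmod (u i))\<^sup>2) \<le> K * W)"
    using half_line_free_solvable[OF k] by metis
  define x where "x = z - \<i> * of_real h"
  obtain L where L: "L \<ge> 0" and block: "\<And>w W. (\<And>i. i < N \<Longrightarrow> cmod (w (i + 1)) \<le> W) \<Longrightarrow> W \<ge> 0 \<Longrightarrow>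
      \<exists>u. u 0 = 0 \<and> u (Suc N) = 0 \<and> (\<forall>i<N. u (i + 2) + u i - x * u (i + 1) = w (i + 1)) \<and>
          (\<forall>i\<le>N. cmod (u i) \<le> L * W)"
    using dirichlet_block_solvable[OF nz] unfolding x_def by metis
  define C where "C = 2 * K + (N + 1) * L\<^sup>2"
  show ?thesis
  proof (rule jacobi_resolvent_setI[where K = "sqrt C"])
    fix w :: "int \<Rightarrow> complex" assume w: "w \<in> lp 2"
    define W where "W = lp_norm 2 w"
    have W: "W \<ge> 0" by (simp add: W_def lp_norm_nonneg)
    obtain l where l: "l 1 - z * l 0 = w 0"
      "\<And>i. l (i + 2) + l i - z * l (i + 1) = w (- int (i + 1))"
      "\<And>n. (\<Sum>i<n. (cmod (l i))\<^sup>2) \<le> K * W\<^sup>2"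
      using half[of "\<lambda>i. w (- int i)" "W\<^sup>2"] lp_2_sum_reindex_le[OF w, of _ "\<lambda>i. - int i"]
      unfolding W_def by (auto simp: inj_on_def)
    obtain r where r: "r 1 - z * r 0 = w (int N + 1)"
      "\<And>i. r (i + 2) + r i - z * r (i + 1) = w (int N + 1 + int (i + 1))"
      "\<And>n. (\<Sum>i<n. (cmod (r i))\<^sup>2) \<le> K * W\<^sup>2"
      using half[of "\<lambda>i. w (int N + 1 + int i)" "W\<^sup>2"]
        lp_2_sum_reindex_le[OF w, of _ "\<lambda>i. int N + 1 + int i"]
      unfolding W_def by (auto simp: inj_on_def)
    obtain s where s: "s 0 = 0" "s (Suc N) = 0"
      "\<And>i. i < N \<Longrightarrow> s (i + 2) + s i - x * s (i + 1) = w (int (i + 1))"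
      "\<And>i. i \<le> N \<Longrightarrow> cmod (s i) \<le> L * W"
      using block[of "\<lambda>i. w (int i)" W] lp_2_norm_le[OF w] W unfolding W_def by auto
    \<comment> \<open>Both boundary values \<open>s 0\<close> and \<open>s (Suc N)\<close> are zero, so the cut bonds are respected.\<close>
    define u where "u m = (if m < 1 then l (nat (- m)) else if m \<le> int N then s (nat m)
      else r (nat (m - int N - 1)))" for m
    have ul: "u (- int i) = l i" and ur: "u (int N + 1 + int i) = r i" for i
      by (auto simp: u_def)
    have us: "u (int i) = s i" if "1 \<le> i" "i \<le> N" for i using that by (auto simp: u_def)
    have "shifted (block_op N h) z u = w"
    proof
      fix m
      consider "m = 0" | i where "m = - int (Suc i)" | "m = int N + 1"
        | i where "m = int N + 1 + int (Suc i)" | i where "i < N" "m = int (Suc i)"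
      proof -
        have "m = 0 \<or> m = - int (Suc (nat (- m - 1))) \<or> m = int N + 1 \<or>
          m = int N + 1 + int (Suc (nat (m - int N - 2))) \<or> (nat (m - 1) < N \<and> m = int (Suc (nat (m - 1))))"
          by auto
        thus thesis using that by metis
      qed
      thus "shifted (block_op N h) z u m = w m"
      proof cases
        case 1
        thus ?thesis using l(1) ul[of 0] ul[of 1] by (simp add: shifted_block_op_left)
      next
        case (2 i)
        show ?thesis unfolding 2 shifted_block_op_left ul using l(2)[of i] by simp
      next
        case 3
        show ?thesis unfolding 3 shifted_block_op_right ur using r(1) by simp
      next
        case (4 i)
        show ?thesis unfolding 4 shifted_block_op_right ur using r(2)[of i] by simp
      next
        case (5 i)
        have "(if m = 1 then 0 else u (m - 1)) = s i"
          using 5 us[of i] s(1) by (cases "i = 0") auto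
        moreover have "(if m = int N then 0 else u (m + 1)) = s (i + 2)"
          using 5 us[of "i + 2"] s(2) by (cases "Suc i = N") (auto simp: add.commute)
        moreover have "u m = s (i + 1)" using 5 us[of "i + 1"] by simp
        ultimately show ?thesis using 5 s(3)[of i]
          by (subst shifted_block_op_inner) (auto simp: x_def algebra_simps)
      qed
    qed
    moreover have bound: "(\<Sum>m\<in>F. (cmod (u m))\<^sup>2) \<le> C * W\<^sup>2" if F: "finite F" for F
    proof -
      obtain n where n: "\<And>m. m \<in> F \<Longrightarrow> nat \<bar>m\<bar> < n"
        using finite_nat_set_iff_bounded[of "(\<lambda>m. nat \<bar>m\<bar>) ` F"] F by auto
      define FL FM FR where "FL = (\<lambda>i. - int i) ` {..<n}" and "FM = int ` {1..N}"
        and "FR = (\<lambda>i. int N + 1 + int i) ` {..<n}"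
      have "F \<subseteq> FL \<union> FM \<union> FR"
      proof
        fix m assume "m \<in> F"
        hence m: "nat \<bar>m\<bar> < n" by (rule n)
        consider "m < 1" | "1 \<le> m" "m \<le> int N" | "m > int N" by linarith
        thus "m \<in> FL \<union> FM \<union> FR"
        proof cases
          case 1
          hence "m \<in> FL" unfolding FL_def using m by (intro image_eqI[of _ _ "nat (- m)"]) auto
          thus ?thesis by simp
        next
          case 2
          hence "m \<in> FM" unfolding FM_def by (intro image_eqI[of _ _ "nat m"]) auto
          thus ?thesis by simp
        next
          case 3
          hence "m \<in> FR"
            unfolding FR_def using m by (intro image_eqI[of _ _ "nat (m - int N - 1)"]) auto
          thus ?thesis by simp
        qed
      qed
      hence "(\<Sum>m\<in>F. (cmod (u m))\<^sup>2) \<le> (\<Sum>m\<in>FL \<union> FM \<union> FR. (cmod (u m))\<^sup>2)"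
        by (intro sum_mono2) (auto simp: FL_def FM_def FR_def)
      also have "\<dots> \<le> (\<Sum>m\<in>FL. (cmod (u m))\<^sup>2) + (\<Sum>m\<in>FM. (cmod (u m))\<^sup>2) + (\<Sum>m\<in>FR. (cmod (u m))\<^sup>2)"
      proof -
        have "(\<Sum>m\<in>A \<union> B. (cmod (u m))\<^sup>2) \<le> (\<Sum>m\<in>A. (cmod (u m))\<^sup>2) + (\<Sum>m\<in>B. (cmod (u m))\<^sup>2)"
          if "finite A" "finite B" for A B
          using sum.union_inter[OF that, of "\<lambda>m. (cmod (u m))\<^sup>2"]
            sum_nonneg[of "A \<inter> B" "\<lambda>m. (cmod (u m))\<^sup>2"] by simp
        from this[of "FL \<union> FM" FR] this[of FL FM] show ?thesis
          by (simp add: FL_def FM_def FR_def)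
      qed
      also have "(\<Sum>m\<in>FL. (cmod (u m))\<^sup>2) = (\<Sum>i<n. (cmod (l i))\<^sup>2)"
        unfolding FL_def by (subst sum.reindex) (auto simp: inj_on_def ul)
      also have "\<dots> \<le> K * W\<^sup>2" by (rule l)
      also have "(\<Sum>m\<in>FR. (cmod (u m))\<^sup>2) = (\<Sum>i<n. (cmod (r i))\<^sup>2)"
        unfolding FR_def by (subst sum.reindex) (auto simp: inj_on_def ur)
      also have "\<dots> \<le> K * W\<^sup>2" by (rule r)
      also have "(\<Sum>m\<in>FM. (cmod (u m))\<^sup>2) = (\<Sum>i\<in>{1..N}. (cmod (s i))\<^sup>2)"
        unfolding FM_def by (subst sum.reindex) (auto simp: us)
      also have "\<dots> \<le> (\<Sum>i\<in>{1..N}. (L * W)\<^sup>2)"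
        by (intro sum_mono power_mono s) auto
      also have "\<dots> = N * L\<^sup>2 * W\<^sup>2" by (simp add: power_mult_distrib)
      also have "K * W\<^sup>2 + N * L\<^sup>2 * W\<^sup>2 + K * W\<^sup>2 \<le> C * W\<^sup>2"
        by (simp add: C_def algebra_simps)
      finally show ?thesis by simp
    qed
    moreover have "sqrt (C * W\<^sup>2) = sqrt C * lp_norm 2 w"
      using W by (simp add: real_sqrt_mult W_def)
    ultimately show "\<exists>u\<in>lp 2. shifted (block_op N h) z u = w \<and> lp_norm 2 u \<le> sqrt C * lp_norm 2 w"
      using lp_2_boundI[of u, OF bound] by metis
  next
    fix u assume u: "u \<in> lp 2" "shifted (block_op N h) z u = 0"
    show "u = 0" by (rule block_op_injective[OF z nz lp_2_norm_le[OF u(1)] u(2)])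
  qed (rule bounded_cut_offdiag bounded_block_potential)+
qed

section \<open>Discrete spectrum of the decoupled operator\<close>

lemma root_space_block_op_supported:
  assumes z: "Im z \<noteq> 0" and u: "u \<in> root_space (block_op N h) z" and m: "m < 1 \<or> m > int N"
  shows "u m = 0"
proof -
  obtain k where "u \<in> lp 2" "(shifted (block_op N h) z ^^ k) u = 0"
    using u by (auto simp: root_space_def)
  thus ?thesis using m
  proof (induction k arbitrary: u m)
    case (Suc k)
    let ?w = "shifted (block_op N h) z u"
    have "?w \<in> lp 2"
      by (intro shifted_jacobi_in_lp_2 bounded_cut_offdiag bounded_block_potential Suc.prems)
    moreover have "(shifted (block_op N h) z ^^ k) ?w = 0"
      using Suc.prems(2) by (simp only: funpow_Suc_right o_apply)
    ultimately have "?w m = 0" if "m < 1 \<or> m > int N" for m using Suc.IH that by blast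
    thus ?case
      by (rule block_op_kernel_outside[OF z lp_2_norm_le[OF Suc.prems(1)] _ Suc.prems(3)])
  qed simp
qed

lemma finite_alg_mult_block_op:
  assumes z: "Im z \<noteq> 0"
  shows "finite_alg_mult (block_op N h) z"
proof -
  define e :: "int \<Rightarrow> int \<Rightarrow> complex" where "e i n = (if n = i then 1 else 0)" for i n
  have "u \<in> cseq.span (e ` {1..int N})" if u: "u \<in> root_space (block_op N h) z" for u
  proof -
    have eval: "(\<Sum>i\<in>A. g i) n = (\<Sum>i\<in>A. g i n)"
      if "finite A" for A :: "int set" and g :: "int \<Rightarrow> int \<Rightarrow> complex" and n
      using that by induction auto
    have "u = (\<Sum>i\<in>{1..int N}. (\<lambda>n. u i * e i n))"
    proof
      fix n
      have "(\<Sum>i\<in>{1..int N}. (\<lambda>n. u i * e i n)) n = (\<Sum>i\<in>{1..int N}. if i = n then u n else 0)"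
        by (subst eval) (simp_all add: e_def if_distrib cong: if_cong sum.cong)
      also have "\<dots> = (if n \<in> {1..int N} then u n else 0)" by simp
      also have "\<dots> = u n" using root_space_block_op_supported[OF z u, of n] by auto
      finally show "u n = (\<Sum>i\<in>{1..int N}. (\<lambda>n. u i * e i n)) n" ..
    qed
    also have "\<dots> \<in> cseq.span (e ` {1..int N})"
      by (intro cseq.span_sum cseq.span_scale cseq.span_base imageI)
    finally show ?thesis .
  qed
  thus ?thesis unfolding finite_alg_mult_def by (intro exI[of _ "e ` {1..int N}"]) auto
qed

lemma alg_mult_ge_1:
  assumes fin: "finite_alg_mult T z" and ev: "is_eigenvalue T z"
  shows "alg_mult T z \<ge> 1"
proof -
  obtain u where u: "u \<in> lp 2" "u \<noteq> 0" "shifted T z u = 0"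
    using ev by (auto simp: is_eigenvalue_def)
  hence mem: "u \<in> root_space T z"
    unfolding root_space_def by (auto intro!: exI[of _ "1::nat"])
  obtain B where B: "finite B" "root_space T z \<subseteq> cseq.span B"
    using fin by (auto simp: finite_alg_mult_def)
  obtain B' where B': "B' \<subseteq> root_space T z" "cseq.independent B'"
    "root_space T z \<subseteq> cseq.span B'" "card B' = cseq.dim (root_space T z)"
    using cseq.basis_exists .
  have "finite B'" using cseq.independent_span_bound[OF B(1) B'(2)] B' B by blast
  moreover have "B' \<noteq> {}" using B'(3) mem u by auto
  ultimately show ?thesis using B'(4) unfolding alg_mult_def by (metis One_nat_def Suc_leI card_gt_0_iff)
qed

text \<open>The eigenvector is the discrete Dirichlet mode \<open>sin (\<theta> m)\<close> on the block, extended by zero.\<close>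

lemma block_op_eigenvalue:
  fixes N j :: nat and h :: real
  assumes j: "1 \<le> j" "j \<le> N"
  defines "\<theta> \<equiv> pi * j / (N + 1)"
  shows "is_eigenvalue (block_op N h) (Complex (2 * cos \<theta>) h)"
proof -
  define u :: "int \<Rightarrow> complex" where
    "u m = (if 1 \<le> m \<and> m \<le> int N then of_real (sin (\<theta> * of_int m)) else 0)" for m
  have "pi * real j < pi * (real N + 1)" using j by (intro mult_strict_left_mono) auto
  hence \<theta>: "0 < \<theta>" "\<theta> < pi" using j by (auto simp: \<theta>_def divide_less_eq)
  have "u \<in> lp 2"
  proof (rule lp_2_boundI)
    fix F :: "int set" assume F: "finite F"
    have "(\<Sum>n\<in>F. (cmod (u n))\<^sup>2) \<le> (\<Sum>n\<in>F \<union> {1..int N}. (cmod (u n))\<^sup>2)"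
      using F by (intro sum_mono2) auto
    also have "\<dots> = (\<Sum>n\<in>{1..int N}. (cmod (u n))\<^sup>2)"
      using F by (intro sum.mono_neutral_right) (auto simp: u_def)
    finally show "(\<Sum>n\<in>F. (cmod (u n))\<^sup>2) \<le> (\<Sum>n\<in>{1..int N}. (cmod (u n))\<^sup>2)" .
  qed
  moreover have "u \<noteq> 0"
  proof
    assume "u = 0"
    hence "u 1 = 0" by simp
    thus False using j sin_gt_zero[OF \<theta>] by (simp add: u_def)
  qed
  moreover have "shifted (block_op N h) (Complex (2 * cos \<theta>) h) u = 0"
  proof
    fix m
    show "shifted (block_op N h) (Complex (2 * cos \<theta>) h) u m = 0 m"
    proof (cases "1 \<le> m \<and> m \<le> int N")
      case False
      thus ?thesis
        by (auto simp: shifted_def jacobi_def u_def cut_offdiag_def block_potential_def)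
    next
      case True
      have "(if m = 1 then 0 else u (m - 1)) = of_real (sin (\<theta> * (of_int m - 1)))"
        using True by (auto simp: u_def)
      moreover have "sin (\<theta> * (real N + 1)) = 0"
      proof -
        have "\<theta> * (real N + 1) = real j * pi" by (simp add: \<theta>_def field_simps)
        thus ?thesis by (simp add: sin_npi)
      qed
      hence "(if m = int N then 0 else u (m + 1)) = of_real (sin (\<theta> * (of_int m + 1)))"
        using True by (auto simp: u_def)
      moreover have "sin (\<theta> * (of_int m - 1)) + sin (\<theta> * (of_int m + 1))
          = 2 * cos \<theta> * sin (\<theta> * of_int m)"
        by (simp add: algebra_simps sin_add sin_diff)
      hence "of_real (sin (\<theta> * (of_int m - 1))) + of_real (sin (\<theta> * (of_int m + 1)))
          = (2 * of_real (cos \<theta>) * of_real (sin (\<theta> * of_int m)) :: complex)"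
        by (metis of_real_add of_real_mult of_real_numeral)
      moreover have "Complex (2 * cos \<theta>) h - \<i> * of_real h = 2 * of_real (cos \<theta>)"
        by (simp add: complex_eq_iff)
      ultimately show ?thesis
        using True by (subst shifted_block_op_inner) (auto simp: u_def)
    qed
  qed
  ultimately show ?thesis unfolding is_eigenvalue_def by blast
qed

lemma eigenvalue_in_op_spectrum:
  assumes "is_eigenvalue (jacobi a b c) z"
  shows "z \<in> op_spectrum (jacobi a b c)"
proof -
  obtain u where u: "u \<in> lp 2" "u \<noteq> 0" "shifted (jacobi a b c) z u = 0"
    using assms by (auto simp: is_eigenvalue_def)
  have "(0 :: int \<Rightarrow> complex) \<in> lp 2" by (simp add: lp_def)
  moreover have "shifted (jacobi a b c) z 0 = 0" by (auto simp: shifted_def jacobi_def)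
  ultimately have "\<not> inj_on (shifted (jacobi a b c) z) (lp 2)"
    using u unfolding inj_on_def by metis
  thus ?thesis by (auto simp: op_spectrum_def resolvent_set_def bij_betw_def)
qed

text \<open>In the upper half-plane the spectrum is contained in the finite set of all \<open>z\<close> such that
  \<open>cheb (N + 1)\<close> vanishes at \<open>z - \<i> h\<close>, so every eigenvalue there is isolated.\<close>

lemma block_op_eigenvalue_discrete:
  fixes N j :: nat and h :: real
  assumes j: "1 \<le> j" "j \<le> N" and h: "h > 0"
  defines "\<theta> \<equiv> pi * j / (N + 1)"
  shows "Complex (2 * cos \<theta>) h \<in> discrete_spectrum (block_op N h)"
    and "alg_mult (block_op N h) (Complex (2 * cos \<theta>) h) \<ge> 1"
proof -
  let ?z = "Complex (2 * cos \<theta>) h"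
  have ev: "is_eigenvalue (block_op N h) ?z"
    unfolding \<theta>_def by (rule block_op_eigenvalue[OF j])
  have fin: "finite_alg_mult (block_op N h) ?z"
    using h by (intro finite_alg_mult_block_op) simp
  define R where "R = {z. poly (cheb (Suc N)) (z - \<i> * of_real h) = 0}"
  have "R \<subseteq> (\<lambda>x. x + \<i> * of_real h) ` {x. poly (cheb (Suc N)) x = 0}"
  proof
    fix z assume "z \<in> R"
    thus "z \<in> (\<lambda>x. x + \<i> * of_real h) ` {x. poly (cheb (Suc N)) x = 0}"
      unfolding R_def by (intro image_eqI[of _ _ "z - \<i> * of_real h"]) (auto simp del: cheb.simps)
  qed
  hence R: "finite R" using finite_cheb_roots finite_surj by blast
  define T where "T = {z. Im z > 0} - (R - {?z})"
  have "open T"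
    unfolding T_def using R
    by (intro open_Diff open_halfspace_Im_gt finite_imp_closed) auto
  moreover have "z = ?z" if "z \<in> T" "z \<in> op_spectrum (block_op N h)" for z
    using that block_op_resolvent_set[of z N h] by (auto simp: T_def R_def op_spectrum_def)
  moreover have "?z \<in> T" using h by (simp add: T_def)
  ultimately have "?z isolated_in op_spectrum (block_op N h)"
    using eigenvalue_in_op_spectrum[OF ev] unfolding isolated_in_def by blast
  thus "?z \<in> discrete_spectrum (block_op N h)"
    using ev fin by (simp add: discrete_spectrum_def)
  show "alg_mult (block_op N h) ?z \<ge> 1" by (rule alg_mult_ge_1[OF fin ev])
qed

section \<open>Lower bounds for the eigenvalue sum\<close>

lemma abs_Im_le_infdist_cut: "\<bar>Im z\<bar> \<le> infdist z cut"
proof -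
  have "\<bar>Im z\<bar> \<le> dist z x" if "x \<in> cut" for x
  proof -
    have "Im x = 0" using that by (auto simp: closed_segment_def)
    thus ?thesis using abs_Im_le_cmod[of "z - x"] by (simp add: dist_norm)
  qed
  thus ?thesis by (subst infdist_notempty) (auto intro!: cINF_greatest)
qed

lemma infdist_cut_le: "infdist z cut \<le> infdist z {- 2, 2}"
  by (rule infdist_mono) auto

text \<open>If \<open>z\<close> lies on the segment, the quotient is \<open>0\<close> and so is \<open>ln 0\<close>; hence no
  assumption on \<open>z\<close> is needed.\<close>

lemma weight_argument_nonneg: "0 \<le> - ln (infdist z cut / infdist z {- 2, 2})"
proof (cases "infdist z cut = 0")
  case False
  hence "0 < infdist z cut" using infdist_nonneg[of z cut] by linarith
  thus ?thesis using infdist_cut_le[of z] by (simp add: ln_div)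
qed simp

lemma eigenvalue_weight_nonneg:
  assumes "\<forall>x\<ge>0. f x > 0"
  shows "0 \<le> eigenvalue_weight p f z"
  using assms weight_argument_nonneg[of z] by (auto simp: eigenvalue_weight_def less_imp_le)

text \<open>The estimate uses \<open>\<bar>z - 2\<bar> \<le> \<theta>\<^sup>2 + h \<le> 2 \<theta>\<^sup>2\<close> and \<open>\<bar>z + 2\<bar> \<le> 5\<close> for \<open>z = 2 cos \<theta> + \<i> h\<close>, whence
  \<open>\<bar>z\<^sup>2 - 4\<bar>\<close> is at most \<open>10 \<theta>\<^sup>2 \<le> (4 \<theta>)\<^sup>2\<close>.\<close>

lemma eigenvalue_weight_ge:
  fixes f :: "real \<Rightarrow> real"
  assumes p: "p \<ge> 0" and anti: "antimono_on {0..} f" and pos: "\<forall>x\<ge>0. f x > 0"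
    and \<theta>: "0 < \<theta>" and h: "0 < h" "h \<le> 1" "h \<le> \<theta>\<^sup>2" and t: "ln (2 * \<theta>\<^sup>2 / h) \<le> t"
  shows "h powr p / (4 * \<theta>) * f t \<le> eigenvalue_weight p f (Complex (2 * cos \<theta>) h)"
proof -
  define z where "z = Complex (2 * cos \<theta>) h"
  define d where "d = infdist z cut"
  define e where "e = infdist z {- 2, 2}"
  have hd: "h \<le> d" using abs_Im_le_infdist_cut[of z] h by (simp add: z_def d_def)
  have de: "d \<le> e" unfolding d_def e_def by (rule infdist_cut_le)
  have "2 - 2 * cos \<theta> = (2 * sin (\<theta> / 2))\<^sup>2"
    using cos_double_sin[of "\<theta> / 2"] by (simp add: power_mult_distrib)
  also have "\<dots> = (2 * \<bar>sin (\<theta> / 2)\<bar>)\<^sup>2" by (simp add: power_mult_distrib)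
  also have "\<dots> \<le> \<theta>\<^sup>2"
    using abs_sin_x_le_abs_x[of "\<theta> / 2"] \<theta> by (intro power_mono) auto
  finally have c: "2 - 2 * cos \<theta> \<le> \<theta>\<^sup>2" .
  have "cmod (z - 2) \<le> \<bar>Re (z - 2)\<bar> + \<bar>Im (z - 2)\<bar>" by (rule cmod_le)
  also have "\<dots> = (2 - 2 * cos \<theta>) + h" using h by (simp add: z_def)
  finally have z2: "cmod (z - 2) \<le> 2 * \<theta>\<^sup>2" using c h by linarith
  have "cmod (z + 2) \<le> \<bar>Re (z + 2)\<bar> + \<bar>Im (z + 2)\<bar>" by (rule cmod_le)
  also have "\<dots> = \<bar>2 * cos \<theta> + 2\<bar> + h" using h by (simp add: z_def)
  also have "\<dots> \<le> 5" using h cos_ge_minus_one[of \<theta>] cos_le_one[of \<theta>] by linarith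
  finally have z2': "cmod (z + 2) \<le> 5" .
  have "cmod (z\<^sup>2 - 4) = cmod (z - 2) * cmod (z + 2)"
    by (simp add: norm_mult[symmetric] algebra_simps power2_eq_square)
  also have "\<dots> \<le> 2 * \<theta>\<^sup>2 * 5" using z2 z2' by (intro mult_mono) auto
  also have "\<dots> \<le> (4 * \<theta>)\<^sup>2" by (simp add: power2_eq_square)
  finally have "sqrt (cmod (z\<^sup>2 - 4)) \<le> 4 * \<theta>" using \<theta> by (intro real_le_lsqrt) auto
  hence den: "cmod (z\<^sup>2 - 4) powr (1 / 2) \<le> 4 * \<theta>" by (simp add: powr_half_sqrt)
  have "z \<noteq> 2" "z \<noteq> -2" using h by (auto simp: z_def complex_eq_iff)
  hence "z\<^sup>2 \<noteq> 2\<^sup>2" by (simp only: power2_eq_iff not_False_eq_True de_Morgan_disj)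
  hence den0: "0 < cmod (z\<^sup>2 - 4) powr (1 / 2)" by simp
  have "e \<le> dist z 2" unfolding e_def by (rule infdist_le) simp
  hence e: "e \<le> 2 * \<theta>\<^sup>2" using z2 by (simp add: dist_norm)
  have "- ln (d / e) = ln (e / d)" using hd de h by (simp add: ln_div)
  also have "\<dots> \<le> ln (2 * \<theta>\<^sup>2 / h)"
    using hd de h e \<theta> by (subst ln_le_cancel_iff) (auto intro!: frac_le)
  finally have "- ln (d / e) \<le> t" using t by simp
  moreover have arg0: "0 \<le> - ln (d / e)" unfolding d_def e_def by (rule weight_argument_nonneg)
  ultimately have f: "f t \<le> f (- ln (d / e))" "0 < f t"
    using monotone_onD[OF anti, of "- ln (d / e)" t] pos by auto
  have "h powr p / (4 * \<theta>) \<le> d powr p / cmod (z\<^sup>2 - 4) powr (1 / 2)"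
    using hd h p den den0 by (intro frac_le powr_mono2) auto
  hence "h powr p / (4 * \<theta>) * f t \<le> d powr p / cmod (z\<^sup>2 - 4) powr (1 / 2) * f (- ln (d / e))"
    using f by (intro mult_mono) auto
  thus ?thesis by (simp add: eigenvalue_weight_def d_def e_def z_def)
qed

lemma sum_dyadic_blocks:
  fixes w :: "nat \<Rightarrow> real"
  shows "(\<Sum>j\<in>{2 ^ a..<2 ^ (a + M)}. w j) = (\<Sum>i<M. \<Sum>j\<in>{2 ^ (a + i)..<2 ^ (a + i + 1)}. w j)"
proof (induction M)
  case (Suc M)
  have "(\<Sum>j\<in>{2 ^ a..<2 ^ (a + Suc M)}. w j) =
      (\<Sum>j\<in>{2 ^ a..<2 ^ (a + M)}. w j) + (\<Sum>j\<in>{2 ^ (a + M)..<2 ^ (a + Suc M)}. w j)"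
    by (rule sum.atLeastLessThan_concat[symmetric]) (auto intro: power_increasing)
  thus ?case using Suc by simp
qed simp

lemma eigenvalue_sum_ge:
  assumes fin: "finite A" "A \<subseteq> discrete_spectrum T" and mult: "\<And>z. z \<in> A \<Longrightarrow> alg_mult T z \<ge> 1"
    and pos: "\<forall>x\<ge>0. f x > 0"
  shows "ereal (\<Sum>z\<in>A. eigenvalue_weight p f z) \<le> eigenvalue_sum p f T"
proof -
  let ?g = "\<lambda>z. ereal (real (alg_mult T z) * eigenvalue_weight p f z)"
  have "(\<Sum>z\<in>A. eigenvalue_weight p f z) \<le> (\<Sum>z\<in>A. real (alg_mult T z) * eigenvalue_weight p f z)"
    using mult eigenvalue_weight_nonneg[OF pos, of p]
    by (intro sum_mono) (metis mult_le_cancel_right1 not_le of_nat_1 of_nat_le_iff)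
  hence "ereal (\<Sum>z\<in>A. eigenvalue_weight p f z) \<le> sum ?g A" by simp
  also have "\<dots> \<le> (SUP F\<in>{F. finite F \<and> F \<subseteq> discrete_spectrum T}. sum ?g F)"
    using fin by (intro SUP_upper) auto
  also have "\<dots> = eigenvalue_sum p f T"
    unfolding eigenvalue_sum_def using eigenvalue_weight_nonneg[OF pos]
    by (intro nonneg_infsum_complete[symmetric]) auto
  finally show ?thesis .
qed

text \<open>Only the eigenvalues with index \<open>j \<ge> 2\<^sup>a\<close> are kept, for which \<open>\<theta>\<^sub>j \<ge> \<surd>h = 2\<^sup>-\<^sup>M\<close>.\<close>

lemma block_op_eigenvalue_sum_ge:
  fixes f :: "real \<Rightarrow> real" and a M :: nat
  assumes p: "p \<ge> 0" and anti: "antimono_on {0..} f" and pos: "\<forall>x\<ge>0. f x > 0"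
  defines "h \<equiv> (1 / 4) ^ M" and "N \<equiv> 2 ^ (a + M) - 1"
  shows "ereal (h powr p * 2 ^ (a + M) / 32 * (\<Sum>i<M. f (7 + 2 * real i)))
    \<le> eigenvalue_sum p f (block_op N h)"
proof -
  have N: "real (N + 1) = 2 ^ (a + M)" by (simp add: N_def of_nat_diff)
  have h: "0 < h" "h \<le> 1" by (auto simp: h_def power_le_one)
  define \<theta> where "\<theta> j = pi * real j / (N + 1)" for j :: nat
  define z where "z j = Complex (2 * cos (\<theta> j)) h" for j
  define J where "J = {2 ^ a..<2 ^ (a + M) :: nat}"
  have J: "1 \<le> j" "j \<le> N" if "j \<in> J" for j
  proof -
    have "1 \<le> (2::nat) ^ a" by simp
    moreover have "2 ^ a \<le> j" "j < 2 ^ (a + M)" using that by (auto simp: J_def)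
    ultimately show "1 \<le> j" "j \<le> N" unfolding N_def by linarith+
  qed
  have "inj_on z J"
  proof (rule inj_onI)
    fix i j assume ij: "i \<in> J" "j \<in> J" "z i = z j"
    have "\<theta> k \<in> {0..pi}" if "k \<in> J" for k
    proof -
      have "pi * real k \<le> pi * real (N + 1)" using J[OF that] by (intro mult_left_mono) auto
      thus ?thesis by (auto simp: \<theta>_def divide_le_eq)
    qed
    hence "\<theta> i = \<theta> j" using ij cos_inj_pi[of "\<theta> i" "\<theta> j"] by (auto simp: z_def)
    thus "i = j" by (simp add: \<theta>_def)
  qed
  have group: "2 ^ (a + M) * (h powr p / 32 * f (7 + 2 * real i))
      \<le> (\<Sum>j\<in>{2 ^ (a + i)..<2 ^ (a + i + 1)}. eigenvalue_weight p f (z j))" if "i < M" for i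
  proof -
    define D where "D = {2 ^ (a + i)..<2 ^ (a + i + 1) :: nat}"
    \<comment> \<open>All angles belonging to the dyadic range lie between \<open>r\<close> and \<open>8 r\<close>.\<close>
    define r :: real where "r = 2 ^ i / 2 ^ M"
    have r: "r > 0" by (simp add: r_def)
    have each: "h powr p / (32 * r) * f (7 + 2 * real i) \<le> eigenvalue_weight p f (z j)"
      if "j \<in> D" for j
    proof -
      have "real (2 ^ (a + i)) \<le> real j" "real j \<le> real (2 ^ (a + i + 1))"
        using that unfolding D_def of_nat_le_iff by auto
      hence "2 ^ (a + i) \<le> real j" "real j \<le> 2 ^ (a + i + 1)"
        by (simp_all only: of_nat_power of_nat_numeral)
      hence "2 ^ (a + i) / 2 ^ (a + M) \<le> real j / 2 ^ (a + M)"
          "real j / 2 ^ (a + M) \<le> 2 ^ (a + i + 1) / 2 ^ (a + M)"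
        by (auto intro: divide_right_mono)
      hence j: "r \<le> real j / 2 ^ (a + M)" "real j / 2 ^ (a + M) \<le> 2 * r"
        by (auto simp: r_def power_add)
      have \<theta>: "\<theta> j = pi * (real j / 2 ^ (a + M))" using N by (simp add: \<theta>_def)
      have "1 * r \<le> \<theta> j" unfolding \<theta> using j pi_gt3 r by (intro mult_mono) auto
      moreover have "\<theta> j \<le> 4 * (2 * r)" unfolding \<theta> using j pi_less_4 r by (intro mult_mono) auto
      ultimately have \<theta>r: "r \<le> \<theta> j" "\<theta> j \<le> 8 * r" by auto
      have hr: "r\<^sup>2 = 4 ^ i * h"
        by (simp add: r_def h_def power_divide power_mult[symmetric] mult.commute[of _ 2])
           (simp add: power_mult)
      have "h powr p / (4 * \<theta> j) * f (7 + 2 * real i) \<le> eigenvalue_weight p f (z j)"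
        unfolding z_def
      proof (rule eigenvalue_weight_ge[OF p anti pos])
        show "0 < \<theta> j" using r \<theta>r by linarith
        have "1 * h \<le> 4 ^ i * h" using h by (intro mult_right_mono) auto
        also have "\<dots> = r\<^sup>2" by (simp add: hr)
        also have "\<dots> \<le> (\<theta> j)\<^sup>2" using r \<theta>r by (intro power_mono) auto
        finally show "h \<le> (\<theta> j)\<^sup>2" by simp
        have "(\<theta> j)\<^sup>2 \<le> (8 * r)\<^sup>2" using r \<theta>r by (intro power_mono) auto
        also have "\<dots> = 64 * (4 ^ i * h)" by (simp add: power_mult_distrib hr)
        finally have "2 * (\<theta> j)\<^sup>2 / h \<le> 128 * 4 ^ i" using h by (simp add: field_simps)
        also have "128 * 4 ^ i = (2 ^ (7 + 2 * i) :: real)" by (simp add: power_add power_mult)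
        finally have "2 * (\<theta> j)\<^sup>2 / h \<le> 2 ^ (7 + 2 * i)" .
        hence "ln (2 * (\<theta> j)\<^sup>2 / h) \<le> ln (2 ^ (7 + 2 * i))"
          using h r \<theta>r by (subst ln_le_cancel_iff) auto
        also have "\<dots> = (7 + 2 * real i) * ln 2" by (simp add: ln_realpow)
        also have "\<dots> \<le> (7 + 2 * real i) * 1"
          using ln_2_less_1 by (intro mult_left_mono) auto
        finally show "ln (2 * (\<theta> j)\<^sup>2 / h) \<le> 7 + 2 * real i" by simp
      qed (rule h)+
      moreover have "h powr p / (32 * r) \<le> h powr p / (4 * \<theta> j)"
        using r \<theta>r by (intro divide_left_mono) auto
      hence "h powr p / (32 * r) * f (7 + 2 * real i) \<le> h powr p / (4 * \<theta> j) * f (7 + 2 * real i)"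
        using pos by (intro mult_right_mono) (auto simp: less_imp_le)
      ultimately show ?thesis by linarith
    qed
    have "2 ^ (a + M) * (h powr p / 32 * f (7 + 2 * real i))
        = real (card D) * (h powr p / (32 * r) * f (7 + 2 * real i))"
      by (simp add: D_def r_def power_add field_simps)
    also have "\<dots> = (\<Sum>j\<in>D. h powr p / (32 * r) * f (7 + 2 * real i))" by simp
    also have "\<dots> \<le> (\<Sum>j\<in>D. eigenvalue_weight p f (z j))" by (intro sum_mono each)
    finally show ?thesis by (simp add: D_def)
  qed
  have "h powr p * 2 ^ (a + M) / 32 * (\<Sum>i<M. f (7 + 2 * real i))
      = (\<Sum>i<M. 2 ^ (a + M) * (h powr p / 32 * f (7 + 2 * real i)))"
    by (simp add: sum_distrib_left mult_ac)
  also have "\<dots> \<le> (\<Sum>i<M. \<Sum>j\<in>{2 ^ (a + i)..<2 ^ (a + i + 1)}. eigenvalue_weight p f (z j))"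
    by (intro sum_mono group) simp
  also have "\<dots> = (\<Sum>j\<in>J. eigenvalue_weight p f (z j))"
    unfolding J_def by (rule sum_dyadic_blocks[symmetric])
  also have "\<dots> = (\<Sum>x\<in>z ` J. eigenvalue_weight p f x)"
    using \<open>inj_on z J\<close> by (simp add: sum.reindex)
  finally have "ereal (h powr p * 2 ^ (a + M) / 32 * (\<Sum>i<M. f (7 + 2 * real i)))
      \<le> ereal (\<Sum>x\<in>z ` J. eigenvalue_weight p f x)" by simp
  also have "\<dots> \<le> eigenvalue_sum p f (block_op N h)"
    using block_op_eigenvalue_discrete[OF J h(1)]
    by (intro eigenvalue_sum_ge pos) (auto simp: J_def z_def \<theta>_def)
  finally show ?thesis .
qed

section \<open>The perturbation norm\<close>

abbreviation block_v :: "nat \<Rightarrow> real \<Rightarrow> int \<Rightarrow> real" where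
  "block_v N h \<equiv> jacobi_v (cut_offdiag N) (block_potential N h) (cut_offdiag N)"

lemma block_v_le_iff:
  "block_v N h m \<le> x \<longleftrightarrow> cmod (cut_offdiag N (m - 1) - 1) \<le> x \<and> cmod (cut_offdiag N m - 1) \<le> x \<and>
     cmod (block_potential N h m) \<le> x"
  unfolding jacobi_v_def by (subst Max_le_iff) auto

lemma block_v_nonneg: "0 \<le> block_v N h m"
  unfolding jacobi_v_def by (rule order_trans[OF norm_ge_zero Max_ge]) auto

lemma block_v_0: "1 \<le> block_v N h 0"
  unfolding jacobi_v_def by (rule Max_ge) (auto simp: cut_offdiag_def)

lemma block_v_lp:
  fixes N :: nat and h p :: real
  assumes p: "p > 0" and h: "0 < h" "h \<le> 1"
  shows "block_v N h \<in> lp p" and "1 \<le> lp_norm p (block_v N h) powr p"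
    and "lp_norm p (block_v N h) powr p \<le> 4 + real N * h powr p"
proof -
  let ?g = "\<lambda>m. norm (block_v N h m) powr p"
  \<comment> \<open>The cut bonds are visible in \<open>v\<close> only at the four sites in \<open>E\<close>.\<close>
  define E where "E = {0, 1, int N, int N + 1}"
  define A where "A = {0..int N + 1}"
  have finA: "finite A" by (simp add: A_def)
  have zero: "?g m = 0" if "m \<notin> A" for m
  proof -
    have "block_v N h m \<le> 0"
      unfolding block_v_le_iff using that by (auto simp: A_def cut_offdiag_def block_potential_def)
    hence "block_v N h m = 0" using block_v_nonneg[of N h m] by linarith
    thus ?thesis by simp
  qed
  have le: "?g m \<le> (if m \<in> E then 1 else 0) + (if m \<in> {1..int N} then h powr p else 0)" for m
  proof -
    have "m \<in> E \<or> m \<notin> E \<and> m \<in> {1..int N} \<or> m \<notin> A" by (auto simp: E_def A_def)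
    then consider "m \<in> E" | "m \<notin> E" "m \<in> {1..int N}" | "m \<notin> A" by blast
    thus ?thesis
    proof cases
      case 1
      have "block_v N h m \<le> 1"
        unfolding block_v_le_iff using h by (auto simp: cut_offdiag_def block_potential_def norm_mult)
      hence "?g m \<le> 1 powr p" using p block_v_nonneg[of N h m] by (intro powr_mono2) auto
      also have "1 powr p \<le> 1 + (if m \<in> {1..int N} then h powr p else 0)" by simp
      finally show ?thesis using 1 by (simp only: if_True)
    next
      case 2
      have "block_v N h m \<le> h"
        unfolding block_v_le_iff using h 2
        by (auto simp: cut_offdiag_def block_potential_def norm_mult E_def)
      hence "?g m \<le> h powr p" using p block_v_nonneg[of N h m] by (intro powr_mono2) auto
      thus ?thesis using 2 by simp
    next
      case 3
      thus ?thesis using zero by simp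
    qed
  qed
  have "?g summable_on UNIV \<longleftrightarrow> ?g summable_on A"
    by (rule summable_on_cong_neutral) (use zero in auto)
  thus "block_v N h \<in> lp p" by (simp add: lp_def A_def)
  have inf: "infsum ?g UNIV = sum ?g A"
    using infsum_cong_neutral[of A UNIV ?g ?g] zero by (simp add: A_def)
  have norm: "lp_norm p (block_v N h) powr p = sum ?g A"
    using p unfolding lp_norm_def inf by (simp add: powr_powr sum_nonneg)
  have "1 powr p \<le> ?g 0" using p block_v_0[of N h] by (intro powr_mono2) auto
  also have "?g 0 \<le> sum ?g A" by (rule member_le_sum) (auto simp: A_def)
  finally show "1 \<le> lp_norm p (block_v N h) powr p" unfolding norm by simp
  have "sum ?g A \<le> (\<Sum>m\<in>A. (if m \<in> E then 1 else 0) + (if m \<in> {1..int N} then h powr p else 0))"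
    by (intro sum_mono le)
  also have "\<dots> = real (card (A \<inter> E)) + real (card (A \<inter> {1..int N})) * h powr p"
    by (simp only: sum.distrib sum_constant mult_1_right flip: sum.inter_restrict[OF finA])
  also have "real (card (A \<inter> E)) \<le> real (card E)"
    by (intro of_nat_mono card_mono) (auto simp: E_def)
  also have "card E \<le> 4" unfolding E_def by (auto simp: card_insert_if)
  also have "A \<inter> {1..int N} = {1..int N}" by (auto simp: A_def)
  finally show "lp_norm p (block_v N h) powr p \<le> 4 + real N * h powr p" unfolding norm by simp
qed

lemma block_coeffs:
  assumes "p > 0" "0 < h" "h \<le> 1"
  shows "(cut_offdiag N, block_potential N h, cut_offdiag N) \<in> jacobi_coeffs p"
proof -
  have "block_v N h \<noteq> 0"
  proof
    assume "block_v N h = 0"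
    thus False using block_v_0[of N h] by simp
  qed
  thus ?thesis
    using block_v_lp(1)[OF assms] bounded_cut_offdiag bounded_block_potential
    by (simp add: jacobi_coeffs_def)
qed

section \<open>Divergence of the supremum\<close>

text \<open>As \<open>f\<close> is non-increasing, it is dominated on \<open>[7 + 2 i, 9 + 2 i)\<close> by its value at the left
  endpoint; bounded sums of these values would make the integral finite.\<close>

lemma sampled_sums_unbounded:
  fixes f :: "real \<Rightarrow> real"
  assumes anti: "antimono_on {0..} f" and pos: "\<forall>x\<ge>0. f x > 0"
    and div: "(\<integral>\<^sup>+x\<in>{0..}. ennreal (f x) \<partial>lborel) = \<infinity>"
  shows "\<exists>M. B \<le> (\<Sum>i<M. f (7 + 2 * real i))"
proof (rule ccontr)
  let ?s = "\<lambda>i::nat. f (7 + 2 * real i)"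
  assume "\<not> ?thesis"
  hence bd: "(\<Sum>i<M. ?s i) \<le> B" for M by (meson linear not_le)
  have s: "?s i \<ge> 0" for i using pos by (simp add: less_imp_le)
  have sm: "summable ?s" by (rule summableI_nonneg_bounded[OF s bd])
  let ?I = "\<lambda>i::nat. {7 + 2 * real i..<9 + 2 * real i}"
  have pt: "ennreal (f x) * indicator {0..} x \<le>
      ennreal (f 0) * indicator {0..<7} x + (\<Sum>i. ennreal (?s i) * indicator (?I i) x)" for x :: real
  proof -
    consider "x < 0" | "0 \<le> x" "x < 7" | "x \<ge> 7" by linarith
    thus ?thesis
    proof cases
      case 2
      hence "f x \<le> f 0" using monotone_onD[OF anti, of 0 x] by simp
      thus ?thesis using 2 by (auto intro!: ennreal_leI add_increasing2)
    next
      case 3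
      define i where "i = nat \<lfloor>(x - 7) / 2\<rfloor>"
      have "real i = of_int \<lfloor>(x - 7) / 2\<rfloor>" using 3 by (simp add: i_def)
      hence "real i \<le> (x - 7) / 2" "(x - 7) / 2 < real i + 1" by linarith+
      hence i: "7 + 2 * real i \<le> x" "x < 9 + 2 * real i" by (simp_all add: field_simps)
      have "ennreal (f x) * indicator {0..} x \<le> ennreal (?s i) * indicator (?I i) x"
        using i 3 monotone_onD[OF anti, of "7 + 2 * real i" x] by (simp add: ennreal_leI)
      also have "\<dots> = (\<Sum>j\<in>{i}. ennreal (?s j) * indicator (?I j) x)"
        by (simp only: sum.insert[OF finite.emptyI] empty_iff not_False_eq_True sum.empty add_0_right)
      also have "\<dots> \<le> (\<Sum>j. ennreal (?s j) * indicator (?I j) x)"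
        by (rule sum_le_suminf) (auto intro: summableI)
      finally show ?thesis by (simp add: add_increasing)
    qed simp
  qed
  have "(\<integral>\<^sup>+x\<in>{0..}. ennreal (f x) \<partial>lborel) \<le>
      (\<integral>\<^sup>+x. ennreal (f 0) * indicator {0..<7::real} x
        + (\<Sum>i. ennreal (?s i) * indicator (?I i) x) \<partial>lborel)"
    by (intro nn_integral_mono pt)
  also have "\<dots> = (\<integral>\<^sup>+x. ennreal (f 0) * indicator {0..<7::real} x \<partial>lborel)
      + (\<Sum>i. \<integral>\<^sup>+x. ennreal (?s i) * indicator (?I i) x \<partial>lborel)"
    by (subst nn_integral_add) (auto simp: nn_integral_suminf)
  also have "(\<integral>\<^sup>+x. ennreal (f 0) * indicator {0..<7::real} x \<partial>lborel) = ennreal (f 0) * ennreal 7"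
    by (simp add: nn_integral_cmult_indicator)
  also have "(\<Sum>i. \<integral>\<^sup>+x. ennreal (?s i) * indicator (?I i) x \<partial>lborel) = (\<Sum>i. ennreal (?s i * 2))"
    by (simp add: nn_integral_cmult_indicator s ennreal_mult)
  also have "\<dots> = ennreal (\<Sum>i. ?s i * 2)"
    using s by (intro suminf_ennreal2 summable_mult2 sm) auto
  also have "ennreal (f 0) * ennreal 7 + \<dots> < \<infinity>"
    by (simp add: ennreal_mult_less_top)
  finally show False using div by simp
qed

theorem theorem3p3:
  fixes p :: real
  assumes "p \<ge> 1"
  shows "\<exists>C>0. \<forall>(\<gamma>::real) (g :: real \<Rightarrow> real).
    2 / 3 < \<gamma> \<longrightarrow> \<gamma> < 1 \<longrightarrow>
    (\<forall>x\<ge>1. g x \<ge> 1) \<longrightarrow>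
    filterlim g at_top at_top \<longrightarrow>
    ((\<lambda>x. g x / x powr (\<gamma> - 2 / 3)) \<longlongrightarrow> 0) at_top \<longrightarrow>
    (\<exists>nstar\<ge>(2::nat). \<forall>f :: real \<Rightarrow> real.
      continuous_on {0..} f \<longrightarrow>
      antimono_on {0..} f \<longrightarrow>
      (\<forall>x\<ge>0. f x > 0) \<longrightarrow>
      (\<integral>\<^sup>+x\<in>{0..}. ennreal (f x) \<partial>lborel) = \<infinity> \<longrightarrow>
      (\<forall>n\<ge>nstar.
        (SUP (a, b, c) \<in> jacobi_coeffs p.
           ereal (1 / lp_norm p (jacobi_v a b c) powr p) * eigenvalue_sum p f (jacobi a b c))
        \<ge> ereal (C * (integral {0..ln (real n powr (2 / 3))} f - 3 * f 0 * ln (g (real n))))))"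
proof -
  have unbounded: "ereal B \<le> (SUP (a, b, c) \<in> jacobi_coeffs p.
      ereal (1 / lp_norm p (jacobi_v a b c) powr p) * eigenvalue_sum p f (jacobi a b c))"
    (is "_ \<le> ?S")
    if anti: "antimono_on {0..} f" and pos: "\<forall>x\<ge>0. f x > 0"
      and div: "(\<integral>\<^sup>+x\<in>{0..}. ennreal (f x) \<partial>lborel) = \<infinity>"
    for f :: "real \<Rightarrow> real" and B :: real
  proof -
    have p: "p > 0" using assms by simp
    obtain M where M: "64 * B \<le> (\<Sum>i<M. f (7 + 2 * real i))"
      using sampled_sums_unbounded[OF anti pos div] by blast
    \<comment> \<open>With \<open>h\<close> fixed by \<open>M\<close>, the block is made so long that \<open>L = h powr p * (N + 1)\<close> exceeds the
      contribution \<open>4\<close> of the cut bonds.\<close>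
    define s where "s = (\<Sum>i<M. f (7 + 2 * real i))"
    have s: "s \<ge> 0" using pos unfolding s_def by (intro sum_nonneg) (auto simp: less_imp_le)
    define h :: real where "h = (1 / 4) ^ M"
    have h: "0 < h" "h \<le> 1" by (auto simp: h_def power_le_one)
    obtain a :: nat where a: "4 / h powr p < 2 ^ a"
      using real_arch_pow[of 2 "4 / h powr p"] by auto
    define L where "L = h powr p * 2 ^ (a + M)"
    have "4 < h powr p * 2 ^ a" using a h by (simp add: field_simps)
    also have "\<dots> \<le> L" unfolding L_def by (intro mult_left_mono power_increasing) auto
    finally have L: "4 < L" .
    define N :: nat where "N = 2 ^ (a + M) - 1"
    define V where "V = lp_norm p (block_v N h) powr p"
    have "V \<le> 4 + real N * h powr p" unfolding V_def by (rule block_v_lp(3)[OF p h])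
    also have "real N * h powr p \<le> L"
      unfolding L_def N_def using h by (simp add: of_nat_diff mult.commute)
    finally have V: "V \<le> 2 * L" using L by simp
    have V1: "1 \<le> V" unfolding V_def by (rule block_v_lp(2)[OF p h])
    have "B \<le> 1 / (2 * L) * (L / 32 * s)" using L M by (simp add: s_def)
    also have "\<dots> \<le> 1 / V * (L / 32 * s)"
      using V V1 L s by (intro mult_right_mono divide_left_mono) auto
    finally have "ereal B \<le> ereal (1 / V) * ereal (L / 32 * s)" by simp
    also have "\<dots> \<le> ereal (1 / V) * eigenvalue_sum p f (block_op N h)"
      using block_op_eigenvalue_sum_ge[OF _ anti pos, of p M a] p V1
      by (intro ereal_mult_left_mono) (simp_all add: L_def h_def N_def s_def)
    also have "\<dots> \<le> ?S"
      unfolding V_def by (rule SUP_upper2[OF block_coeffs[OF p h, of N]]) simp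
    finally show ?thesis .
  qed
  show ?thesis
    by (rule exI[of _ 1]) (use unbounded in \<open>auto intro!: exI[of _ "2::nat"]\<close>)
qed

end
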